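(* Let $\mu_0\neq\mu_1$ in $\mathcal M$ and let $(\mu_t,V_t,h_t)_{t\in[0,1]}\in\mathcal{CE}_p(\mu_0,\mu_1;[0,1])$ be an action-minimizing trajectory, i.e. one minimizing $\mathfrak E^{a,b}_{\rm Quad}$ over $\mathcal{CE}_p(\mu_0,\mu_1;[0,1])$. Then $h_t\neq0$ for a.e. $t\in[0,1]$.
   Context: Setting. $\mathcal X$ is a finite set, $K:\mathcal X\times\mathcal X\to[0,\infty)$ an irreducible Markov kernel ($\sum_y K(x,y)=1$) with unique invariant probability $\varpi$ ($\varpi(x)=\sum_y\varpi(y)K(y,x)$, $\sum_y\varpi(y)=1$), assumed reversible: $K(x,y)\varpi(x)=K(y,x)\varpi(y)$. $\mathcal M$ is the set of $\mu:\mathcal X\to[0,\infty)$ and $\mathcal M_+$ the set of $\mu:\mathcal X\to(0,\infty)$. Fix $a,b>0$ and $p\in\mathcal M_+$ with $\sum_x p(x)\varpi(x)=1$. Notation. $(\nabla\cdot\Psi)(x)=\frac12\sum_y(\Psi(x,y)-\Psi(y,x))K(x,y)$ for $\Psi\in\mathbb R^{\mathcal X\times\mathcal X}$. Logarithmic mean: $\theta(u,v)=\int_0^1u^\xi v^{1-\xi}\,d\xi$ for $u,v\ge0$, i.e. $\theta(u,u)=u$, $\theta(u,v)=\frac{u-v}{\log u-\log v}$ for $u\ne v$ positive, and $\theta(u,v)=0$ if $u=0$ or $v=0$. Flux formulation. $\mathcal{CE}_p(\mu_0,\mu_1;[0,1])$ is the set of triples $(\mu_t,V_t,h_t)_{t\in[0,1]}$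 with $t\mapsto\mu_t\in\mathcal M$ absolutely continuous with endpoints $\mu_0$ (at $t=0$) and $\mu_1$ (at $t=1$), $V:[0,1]\to\mathbb R^{\mathcal X\times\mathcal X}$ and $h:[0,1]\to\mathbb R$ measurable, and $\dot\mu_t+\nabla\cdot V_t=h_tp$ for a.e. $t$. Let $\alpha(v,s,t)=v^2/\theta(s,t)$ for $v\in\mathbb R$, $s,t\ge0$, with $v^2/0=0$ if $v=0$ and $v^2/0=+\infty$ if $v\neq0$; $A'(\mu,V)=\frac12\sum_{x,y}\alpha(V(x,y),\mu(x),\mu(y))K(x,y)\varpi(x)$ (with $0\cdot\infty=0$); and $\mathfrak E^{a,b}_{\rm Quad}((\mu_t,V_t,h_t)_{t\in[0,1]})=a^2\int_0^1|h_t|^2dt+b^2\int_0^1A'(\mu_t,V_t)\,dt\in[0,\infty]$. (The infimum of $\mathfrak E^{a,b}_{\rm Quad}$ over $\mathcal{CE}_p(\mu_0,\mu_1;[0,1])$ is finite for all $\mu_0,\mu_1\in\mathcal M$.) *)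

theory Defs
  imports "HOL-Analysis.Analysis"
begin

section \<open>Markov kernels on a finite set\<close>

definition markov_kernel :: "('a::finite \<Rightarrow> 'a \<Rightarrow> real) \<Rightarrow> bool" where
  "markov_kernel K \<longleftrightarrow> (\<forall>x y. 0 \<le> K x y) \<and> (\<forall>x. (\<Sum>y\<in>UNIV. K x y) = 1)"

primrec kernel_pow :: "('a::finite \<Rightarrow> 'a \<Rightarrow> real) \<Rightarrow> nat \<Rightarrow> 'a \<Rightarrow> 'a \<Rightarrow> real" where
  "kernel_pow K 0 x y = (if x = y then 1 else 0)"
| "kernel_pow K (Suc n) x y = (\<Sum>z\<in>UNIV. K x z * kernel_pow K n z y)"

definition irreducible_kernel :: "('a::finite \<Rightarrow> 'a \<Rightarrow> real) \<Rightarrow> bool" where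
  "irreducible_kernel K \<longleftrightarrow> (\<forall>x y. \<exists>n. 0 < kernel_pow K n x y)"

definition invariant_probability ::
    "('a::finite \<Rightarrow> 'a \<Rightarrow> real) \<Rightarrow> ('a \<Rightarrow> real) \<Rightarrow> bool" where
  "invariant_probability K \<pi> \<longleftrightarrow>
     (\<forall>x. 0 \<le> \<pi> x) \<and> (\<Sum>y\<in>UNIV. \<pi> y) = 1 \<and> (\<forall>x. \<pi> x = (\<Sum>y\<in>UNIV. \<pi> y * K y x))"

definition reversible_kernel ::
    "('a::finite \<Rightarrow> 'a \<Rightarrow> real) \<Rightarrow> ('a \<Rightarrow> real) \<Rightarrow> bool" where
  "reversible_kernel K \<pi> \<longleftrightarrow> (\<forall>x y. K x y * \<pi> x = K y x * \<pi> y)"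

text \<open>Densities with respect to \<open>\<pi>\<close>.\<close>

definition densities :: "('a::finite \<Rightarrow> real) set" where
  "densities = {\<mu>. \<forall>x. 0 \<le> \<mu> x}"

definition pos_densities :: "('a::finite \<Rightarrow> real) set" where
  "pos_densities = {\<mu>. \<forall>x. 0 < \<mu> x}"

definition divergence ::
    "('a::finite \<Rightarrow> 'a \<Rightarrow> real) \<Rightarrow> ('a \<Rightarrow> 'a \<Rightarrow> real) \<Rightarrow> 'a \<Rightarrow> real" where
  "divergence K \<Psi> x = 1/2 * (\<Sum>y\<in>UNIV. (\<Psi> x y - \<Psi> y x) * K x y)"


section \<open>The logarithmic mean\<close>

text \<open>In HOL \<open>0 powr 0 = 0\<close>, which differs from the usual convention only at the endpoints of the
  interval and hence does not affect the integral.\<close>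

definition log_mean :: "real \<Rightarrow> real \<Rightarrow> real" where
  "log_mean u v = integral {0..1} (\<lambda>\<xi>. u powr \<xi> * v powr (1 - \<xi>))"

lemma log_mean_zero [simp]: "log_mean 0 v = 0" "log_mean u 0 = 0"
  by (simp_all add: log_mean_def)

lemma log_mean_same: "0 \<le> u \<Longrightarrow> log_mean u u = u"
  by (cases "u = 0") (simp_all add: log_mean_def flip: powr_add)

lemma log_mean_diff:
  assumes "0 < u" "0 < v" "u \<noteq> v"
  shows "log_mean u v = (u - v) / (ln u - ln v)"
proof -
  define F where "F = (\<lambda>\<xi>. u powr \<xi> * v powr (1 - \<xi>) / (ln u - ln v))"
  have ne: "ln u - ln v \<noteq> 0" using assms by simp
  have "((\<lambda>\<xi>. u powr \<xi> * v powr (1 - \<xi>)) has_integral (F 1 - F 0)) {0..1}"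
  proof (rule fundamental_theorem_of_calculus)
    fix x :: real
    have "(F has_real_derivative
        (u powr x * ln u * v powr (1 - x) - u powr x * (v powr (1 - x) * ln v)) / (ln u - ln v))
        (at x within {0..1})"
      unfolding F_def powr_def using assms
      by (intro DERIV_cdivide) (auto intro!: derivative_eq_intros simp: algebra_simps)
    also have "(u powr x * ln u * v powr (1 - x) - u powr x * (v powr (1 - x) * ln v)) / (ln u - ln v)
        = u powr x * v powr (1 - x)"
      using ne by (simp add: field_simps)
    finally show "(F has_vector_derivative u powr x * v powr (1 - x)) (at x within {0..1})"
      by (simp add: has_real_derivative_iff_has_vector_derivative)
  qed simp
  then show ?thesis
    using assms by (simp add: log_mean_def F_def integral_unique diff_divide_distrib)
qed


section \<open>Continuity equation and action\<close>

text \<open>The usual \<open>\<epsilon>\<close>-\<open>\<delta>\<close> definition; the members of a division are finitely many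
  nonoverlapping compact intervals, with endpoints \<open>Inf k\<close> and \<open>Sup k\<close>. The library's
  \<open>absolutely_continuous\<close> is the unrelated notion for measures.\<close>

definition absolutely_continuous_on :: "real set \<Rightarrow> (real \<Rightarrow> real) \<Rightarrow> bool" where
  "absolutely_continuous_on S f \<longleftrightarrow>
     (\<forall>\<epsilon>>0. \<exists>\<delta>>0. \<forall>D T. D division_of T \<and> T \<subseteq> S \<and> (\<Sum>k\<in>D. Sup k - Inf k) < \<delta>
        \<longrightarrow> (\<Sum>k\<in>D. \<bar>f (Sup k) - f (Inf k)\<bar>) < \<epsilon>)"

text \<open>Trajectories are total functions on the reals, but only their values on \<open>[0, 1]\<close> matter.
  Absolute continuity of a path in the finite-dimensional space of functions on \<open>'a\<close> is
  absolute continuity of each coordinate.\<close>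

type_synonym 'a trajectory =
  "(real \<Rightarrow> 'a \<Rightarrow> real) \<times> (real \<Rightarrow> 'a \<Rightarrow> 'a \<Rightarrow> real) \<times> (real \<Rightarrow> real)"

definition CE ::
    "('a::finite \<Rightarrow> 'a \<Rightarrow> real) \<Rightarrow> ('a \<Rightarrow> real) \<Rightarrow> ('a \<Rightarrow> real) \<Rightarrow> ('a \<Rightarrow> real) \<Rightarrow> 'a trajectory set" where
  "CE K p \<mu>0 \<mu>1 = {(\<mu>, V, h).
     (\<forall>t\<in>{0..1}. \<mu> t \<in> densities) \<and>
     (\<forall>x. absolutely_continuous_on {0..1} (\<lambda>t. \<mu> t x)) \<and>
     \<mu> 0 = \<mu>0 \<and> \<mu> 1 = \<mu>1 \<and>
     (\<forall>x y. (\<lambda>t. V t x y) \<in> borel_measurable (lebesgue_on {0..1})) \<and>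
     h \<in> borel_measurable (lebesgue_on {0..1}) \<and>
     (AE t in lebesgue_on {0..1}. \<forall>x. \<exists>d.
        ((\<lambda>s. \<mu> s x) has_real_derivative d) (at t within {0..1}) \<and>
        d + divergence K (V t) x = h t * p x)}"

definition action_density :: "real \<Rightarrow> real \<Rightarrow> real \<Rightarrow> ennreal" where
  "action_density v s t =
     (if log_mean s t = 0 then (if v = 0 then 0 else \<infinity>) else ennreal (v\<^sup>2 / log_mean s t))"

text \<open>Multiplication on \<^typ>\<open>ennreal\<close> satisfies \<open>0 * \<infinity> = 0\<close>.\<close>

definition flux_action ::
    "('a::finite \<Rightarrow> 'a \<Rightarrow> real) \<Rightarrow> ('a \<Rightarrow> real) \<Rightarrow> ('a \<Rightarrow> real) \<Rightarrow> ('a \<Rightarrow> 'a \<Rightarrow> real) \<Rightarrow> ennreal" where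
  "flux_action K \<pi> \<mu> V =
     ennreal (1/2) * (\<Sum>x\<in>UNIV. \<Sum>y\<in>UNIV.
       action_density (V x y) (\<mu> x) (\<mu> y) * ennreal (K x y) * ennreal (\<pi> x))"

definition quad_energy ::
    "real \<Rightarrow> real \<Rightarrow> ('a::finite \<Rightarrow> 'a \<Rightarrow> real) \<Rightarrow> ('a \<Rightarrow> real) \<Rightarrow> 'a trajectory \<Rightarrow> ennreal" where
  "quad_energy a b K \<pi> = (\<lambda>(\<mu>, V, h).
     ennreal (a\<^sup>2) * (\<integral>\<^sup>+t. ennreal (\<bar>h t\<bar>\<^sup>2) \<partial>lebesgue_on {0..1}) +
     ennreal (b\<^sup>2) * (\<integral>\<^sup>+t. flux_action K \<pi> (\<mu> t) (V t) \<partial>lebesgue_on {0..1}))"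

end

theory Submission
  imports Defs
begin

text \<open>
  Write \<open>e t\<close> for the integrand of the energy and suppose that \<open>Z = {t. h t = 0}\<close> has positive
  measure \<open>G\<close>. Two competitors show that this is impossible for a minimizer.

  The first is a time change. The energy is an integral of a squared speed, so a minimizer of finite
  energy runs at constant speed: \<open>e\<close> is a.e. equal to the minimal energy \<open>E\<close>
  (\<open>minimizer_constant_speed\<close>). Moreover \<open>0 < E < \<infinity>\<close>: a curve of zero energy has derivative
  zero a.e. and is constant (\<open>CE_zero_energy\<close>), whereas \<open>\<mu>0 \<noteq> \<mu>1\<close>; and \<open>ex_finite_energy\<close> connects
  any two densities at finite cost. Hence the flux action equals the positive number \<open>E / b\<^sup>2\<close> at
  almost every time of \<open>Z\<close>, where the source term contributes nothing.

  The second adds mass. If \<open>\<psi>\<close> is bounded and vanishes off \<open>Z\<close>, then \<open>h * \<psi> = 0\<close>, so replacing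
  \<open>h\<close> by \<open>h + \<epsilon> * \<psi>\<close> raises the cost of the source only by \<open>O(\<epsilon>\<^sup>2)\<close>. The density becomes
  \<open>\<mu> + \<epsilon> * \<phi> * p\<close> with \<open>\<phi>\<close> the primitive of \<open>\<psi>\<close>. If \<open>\<phi> \<ge> 0\<close> and \<open>\<phi>\<close> vanishes
  at both ends, this is a competitor, and its flux action drops to first order in \<open>\<epsilon>\<close> wherever \<open>\<phi> > 0\<close> and the flux is nonzero: the logarithmic mean
  is increasing and homogeneous of degree one. So a minimizer has zero flux action a.e. on
  \<open>{t. \<phi> t \<noteq> 0}\<close> (\<open>minimizer_no_flux_where_mass_can_be_added\<close>).

  With \<open>g t\<close> the measure of \<open>Z \<inter> {0..t}\<close>, the choice \<open>\<phi> = g * (G - g)\<close> is admissible: by Lebesgue's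
  differentiation theorem its derivative is \<open>G - 2 * g\<close> on \<open>Z\<close> and zero off \<open>Z\<close>, almost everywhere.
  The two facts together force \<open>\<phi> = 0\<close> a.e. on \<open>Z\<close>. But \<open>\<phi>\<close> cut off to zero outside \<open>Z\<close> is
  a.e. the derivative of \<open>G * g\<^sup>2 / 2 - g ^ 3 / 3\<close>, which grows from \<open>0\<close> to \<open>G ^ 3 / 6\<close>. So \<open>G = 0\<close>.
\<close>

section \<open>Absolutely continuous functions on an interval\<close>

lemma division_of_intervalE:
  fixes D :: "real set set"
  assumes "D division_of T" "T \<subseteq> {a..b}" "k \<in> D"
  obtains u v where "k = {u..v}" "u \<le> v" "a \<le> u" "v \<le> b"
proof -
  obtain u v where uv: "k = cbox u v" using division_ofD(4)[OF assms(1,3)] by blast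
  moreover have "k \<noteq> {}" "k \<subseteq> {a..b}"
    using division_ofD(2,3)[OF assms(1,3)] assms(2) by auto
  ultimately show thesis using that[of u v] by auto
qed

lemma absolutely_continuous_onI_lipschitz:
  assumes L: "L-lipschitz_on {a..b} f"
  shows "absolutely_continuous_on {a..b} f"
  unfolding absolutely_continuous_on_def
proof (intro allI impI)
  fix \<epsilon> :: real assume "0 < \<epsilon>"
  have L0: "0 \<le> L" using L lipschitz_on_nonneg by blast
  show "\<exists>\<delta>>0. \<forall>D T. D division_of T \<and> T \<subseteq> {a..b} \<and> (\<Sum>k\<in>D. Sup k - Inf k) < \<delta>
        \<longrightarrow> (\<Sum>k\<in>D. \<bar>f (Sup k) - f (Inf k)\<bar>) < \<epsilon>"
  proof (intro exI[of _ "\<epsilon> / (L + 1)"] conjI allI impI)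
    show "0 < \<epsilon> / (L + 1)" using \<open>0 < \<epsilon>\<close> L0 by simp
    fix D T assume H: "D division_of T \<and> T \<subseteq> {a..b} \<and> (\<Sum>k\<in>D. Sup k - Inf k) < \<epsilon> / (L + 1)"
    have *: "\<bar>f (Sup k) - f (Inf k)\<bar> \<le> (L + 1) * (Sup k - Inf k)" if k: "k \<in> D" for k
    proof -
      obtain u v where "k = {u..v}" "u \<le> v" "a \<le> u" "v \<le> b"
        using H k by (blast elim: division_of_intervalE)
      then have "Sup k = v" "Inf k = u" "u \<le> v" "u \<in> {a..b}" "v \<in> {a..b}" by auto
      then have "\<bar>f (Sup k) - f (Inf k)\<bar> \<le> L * (v - u)"
        using lipschitz_onD[OF L, of v u] by (simp add: dist_real_def)
      also have "\<dots> \<le> (L + 1) * (v - u)" using \<open>u \<le> v\<close> by (simp add: algebra_simps)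
      finally show ?thesis using \<open>Sup k = v\<close> \<open>Inf k = u\<close> by simp
    qed
    have "(\<Sum>k\<in>D. \<bar>f (Sup k) - f (Inf k)\<bar>) \<le> (L + 1) * (\<Sum>k\<in>D. Sup k - Inf k)"
      unfolding sum_distrib_left by (intro sum_mono *)
    also have "\<dots> < (L + 1) * (\<epsilon> / (L + 1))"
      using H L0 by (intro mult_strict_left_mono) auto
    finally show "(\<Sum>k\<in>D. \<bar>f (Sup k) - f (Inf k)\<bar>) < \<epsilon>" using L0 by simp
  qed
qed

lemma absolutely_continuous_on_add:
  assumes f: "absolutely_continuous_on S f" and g: "absolutely_continuous_on S g"
  shows "absolutely_continuous_on S (\<lambda>t. f t + g t)"
  unfolding absolutely_continuous_on_def
proof (intro allI impI)
  fix \<epsilon> :: real assume "0 < \<epsilon>"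
  then have h: "\<epsilon> / 2 > 0" by simp
  obtain d1 where d1: "d1 > 0" "\<And>D T. D division_of T \<and> T \<subseteq> S \<and> (\<Sum>k\<in>D. Sup k - Inf k) < d1
        \<Longrightarrow> (\<Sum>k\<in>D. \<bar>f (Sup k) - f (Inf k)\<bar>) < \<epsilon> / 2"
    using f h unfolding absolutely_continuous_on_def by metis
  obtain d2 where d2: "d2 > 0" "\<And>D T. D division_of T \<and> T \<subseteq> S \<and> (\<Sum>k\<in>D. Sup k - Inf k) < d2
        \<Longrightarrow> (\<Sum>k\<in>D. \<bar>g (Sup k) - g (Inf k)\<bar>) < \<epsilon> / 2"
    using g h unfolding absolutely_continuous_on_def by metis
  show "\<exists>\<delta>>0. \<forall>D T. D division_of T \<and> T \<subseteq> S \<and> (\<Sum>k\<in>D. Sup k - Inf k) < \<delta>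
        \<longrightarrow> (\<Sum>k\<in>D. \<bar>(f (Sup k) + g (Sup k)) - (f (Inf k) + g (Inf k))\<bar>) < \<epsilon>"
  proof (intro exI[of _ "min d1 d2"] conjI allI impI)
    show "0 < min d1 d2" using d1 d2 by simp
    fix D T assume H: "D division_of T \<and> T \<subseteq> S \<and> (\<Sum>k\<in>D. Sup k - Inf k) < min d1 d2"
    have "(\<Sum>k\<in>D. \<bar>(f (Sup k) + g (Sup k)) - (f (Inf k) + g (Inf k))\<bar>)
        \<le> (\<Sum>k\<in>D. \<bar>f (Sup k) - f (Inf k)\<bar> + \<bar>g (Sup k) - g (Inf k)\<bar>)"
      by (intro sum_mono) linarith
    also have "\<dots> < \<epsilon> / 2 + \<epsilon> / 2"
      unfolding sum.distrib using H d1(2)[of D T] d2(2)[of D T] by (intro add_strict_mono) auto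
    finally show "(\<Sum>k\<in>D. \<bar>(f (Sup k) + g (Sup k)) - (f (Inf k) + g (Inf k))\<bar>) < \<epsilon>" by simp
  qed
qed

lemma absolutely_continuous_on_imp_continuous_on:
  assumes f: "absolutely_continuous_on {a..b} f"
  shows "continuous_on {a..b} f"
  unfolding continuous_on_iff
proof (intro ballI allI impI)
  fix x e :: real assume x: "x \<in> {a..b}" and e: "e > 0"
  obtain d where d: "d > 0" "\<And>D T. D division_of T \<and> T \<subseteq> {a..b} \<and> (\<Sum>k\<in>D. Sup k - Inf k) < d
        \<Longrightarrow> (\<Sum>k\<in>D. \<bar>f (Sup k) - f (Inf k)\<bar>) < e"
    using f e unfolding absolutely_continuous_on_def by metis
  show "\<exists>d>0. \<forall>y\<in>{a..b}. dist y x < d \<longrightarrow> dist (f y) (f x) < e"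
  proof (intro exI[of _ d] conjI ballI impI)
    fix y assume y: "y \<in> {a..b}" "dist y x < d"
    have "{{min x y..max x y}} division_of {min x y..max x y}"
      using division_of_self[of "min x y" "max x y"] by (simp add: box_real)
    from d(2)[OF conjI[OF this]] have "\<bar>f (max x y) - f (min x y)\<bar> < e"
      using x y by (auto simp: dist_real_def)
    then show "dist (f y) (f x) < e"
      by (auto simp: dist_real_def min_def max_def split: if_splits)
  qed (use d in auto)
qed

text \<open>
  An increasing Lipschitz map carries a division to a division and stretches the total length by at
  most its Lipschitz constant. Strict monotonicity keeps the images of distinct members distinct.
\<close>

lemma absolutely_continuous_on_compose:
  assumes f: "absolutely_continuous_on {c..d} f"
    and L: "L-lipschitz_on {a..b} g" and mono: "strict_mono_on {a..b} g"
    and img: "g ` {a..b} \<subseteq> {c..d}"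
  shows "absolutely_continuous_on {a..b} (\<lambda>t. f (g t))"
  unfolding absolutely_continuous_on_def
proof (intro allI impI)
  fix \<epsilon> :: real assume "0 < \<epsilon>"
  have L0: "0 \<le> L" using L lipschitz_on_nonneg by blast
  obtain e where e: "e > 0" "\<And>D T. D division_of T \<and> T \<subseteq> {c..d} \<and> (\<Sum>k\<in>D. Sup k - Inf k) < e
        \<Longrightarrow> (\<Sum>k\<in>D. \<bar>f (Sup k) - f (Inf k)\<bar>) < \<epsilon>"
    using f \<open>0 < \<epsilon>\<close> unfolding absolutely_continuous_on_def by metis
  have inj: "inj_on g {a..b}" using mono by (rule strict_mono_on_imp_inj_on)
  have mg: "g x \<le> g y \<longleftrightarrow> x \<le> y" if "x \<in> {a..b}" "y \<in> {a..b}" for x y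
    using strict_mono_on_leD[OF mono] strict_mono_onD[OF mono] that by (meson linorder_not_le)
  have cont: "continuous_on {a..b} g"
    using L by (rule lipschitz_on_continuous_on)
  show "\<exists>\<delta>>0. \<forall>D T. D division_of T \<and> T \<subseteq> {a..b} \<and> (\<Sum>k\<in>D. Sup k - Inf k) < \<delta>
        \<longrightarrow> (\<Sum>k\<in>D. \<bar>f (g (Sup k)) - f (g (Inf k))\<bar>) < \<epsilon>"
  proof (intro exI[of _ "e / (L + 1)"] conjI allI impI)
    show "0 < e / (L + 1)" using e L0 by simp
    fix D T assume H: "D division_of T \<and> T \<subseteq> {a..b} \<and> (\<Sum>k\<in>D. Sup k - Inf k) < e / (L + 1)"
    have int: "\<exists>u v. k = {u..v} \<and> u \<le> v \<and> a \<le> u \<and> v \<le> b" if kD: "k \<in> D" for k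
      using H kD by (blast elim: division_of_intervalE)
    have im: "g ` {u..v} = {g u..g v}" if uv: "u \<le> v" "a \<le> u" "v \<le> b" for u v
    proof
      show "g ` {u..v} \<subseteq> {g u..g v}" using that mg by auto
      show "{g u..g v} \<subseteq> g ` {u..v}"
      proof
        fix y assume "y \<in> {g u..g v}"
        then obtain x where "u \<le> x" "x \<le> v" "g x = y"
          using IVT'[of g u y v] continuous_on_subset[OF cont, of "{u..v}"] uv by auto
        then show "y \<in> g ` {u..v}" by auto
      qed
    qed
    have SI: "Sup (g ` k) = g (Sup k) \<and> Inf (g ` k) = g (Inf k)" if kD: "k \<in> D" for k
    proof -
      obtain u v where uv: "k = {u..v}" "u \<le> v" "a \<le> u" "v \<le> b" using int[OF kD] by blast
      moreover have "g u \<le> g v" using uv mg by auto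
      ultimately show ?thesis using im[of u v] by simp
    qed
    have injD: "inj_on ((`) g) D"
    proof (rule inj_onI)
      fix k l assume "k \<in> D" "l \<in> D" "g ` k = g ` l"
      moreover have "k \<subseteq> {a..b}" "l \<subseteq> {a..b}" using int[OF \<open>k \<in> D\<close>] int[OF \<open>l \<in> D\<close>] by auto
      ultimately show "k = l" using inj inj_on_image_eq_iff by metis
    qed
    have div: "(`) g ` D division_of g ` T"
    proof (rule division_ofI)
      show "finite ((`) g ` D)" using H by blast
      show "\<Union> ((`) g ` D) = g ` T"
        using H division_ofD(6)[of D T] by (auto simp: image_Union)
      fix K assume "K \<in> (`) g ` D"
      then obtain k where k: "k \<in> D" "K = g ` k" by auto
      then obtain u v where uv: "k = {u..v}" "u \<le> v" "a \<le> u" "v \<le> b" using int by blast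
      show "K \<subseteq> g ` T" using k H division_ofD(2) by blast
      show "K \<noteq> {}" using k uv by auto
      show "\<exists>a b. K = cbox a b" using k uv im by (metis box_real(2))
      fix K' assume "K' \<in> (`) g ` D" and ne: "K \<noteq> K'"
      then obtain k' where k': "k' \<in> D" "K' = g ` k'" by auto
      then obtain u' v' where uv': "k' = {u'..v'}" "u' \<le> v'" "a \<le> u'" "v' \<le> b" using int by blast
      have "interior k \<inter> interior k' = {}"
        using H k k' ne division_ofD(5) by metis
      then have "{u<..<v} \<inter> {u'<..<v'} = {}" using uv uv' by simp
      then have disj: "v \<le> u' \<or> v' \<le> u \<or> u = v \<or> u' = v'"
      proof (rule contrapos_pp)
        assume "\<not> (v \<le> u' \<or> v' \<le> u \<or> u = v \<or> u' = v')"
        then have "max u u' < min v v'" using uv uv' by auto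
        then obtain z where "max u u' < z" "z < min v v'" using dense by blast
        then have "z \<in> {u<..<v} \<inter> {u'<..<v'}" by auto
        then show "{u<..<v} \<inter> {u'<..<v'} \<noteq> {}" by blast
      qed
      have "g v \<le> g u' \<or> g v' \<le> g u \<or> g u = g v \<or> g u' = g v'"
        using disj mg uv uv' by auto
      moreover have "K = {g u..g v}" "K' = {g u'..g v'}" using k uv k' uv' im by auto
      ultimately show "interior K \<inter> interior K' = {}" by auto
    qed
    have len: "(\<Sum>k\<in>(`) g ` D. Sup k - Inf k) \<le> (L + 1) * (\<Sum>k\<in>D. Sup k - Inf k)"
    proof -
      have "(\<Sum>k\<in>(`) g ` D. Sup k - Inf k) = (\<Sum>k\<in>D. g (Sup k) - g (Inf k))"
        using SI by (simp add: sum.reindex[OF injD] cong: sum.cong)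
      also have "\<dots> \<le> (\<Sum>k\<in>D. (L + 1) * (Sup k - Inf k))"
      proof (rule sum_mono)
        fix k assume "k \<in> D"
        then obtain u v where uv: "k = {u..v}" "u \<le> v" "a \<le> u" "v \<le> b" using int by blast
        have "g v - g u \<le> L * (v - u)"
          using lipschitz_onD[OF L, of v u] uv by (simp add: dist_real_def)
        also have "\<dots> \<le> (L + 1) * (v - u)" using uv by (simp add: algebra_simps)
        finally show "g (Sup k) - g (Inf k) \<le> (L + 1) * (Sup k - Inf k)" using uv by simp
      qed
      finally show ?thesis by (simp add: sum_distrib_left)
    qed
    also have "\<dots> < (L + 1) * (e / (L + 1))"
      using H L0 by (intro mult_strict_left_mono) auto
    finally have "(\<Sum>k\<in>(`) g ` D. Sup k - Inf k) < e" using L0 by simp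
    moreover have "g ` T \<subseteq> {c..d}" using H img by blast
    ultimately have "(\<Sum>k\<in>(`) g ` D. \<bar>f (Sup k) - f (Inf k)\<bar>) < \<epsilon>" using e(2) div by blast
    then show "(\<Sum>k\<in>D. \<bar>f (g (Sup k)) - f (g (Inf k))\<bar>) < \<epsilon>"
      using SI by (simp add: sum.reindex[OF injD] cong: sum.cong)
  qed
qed

text \<open>
  The increment of \<open>f\<close> telescopes over a tagged division. Choose a gauge so fine that an interval
  tagged outside \<open>N\<close> contributes at most \<open>\<eta>\<close> times its length, while an interval tagged in \<open>N\<close> lies
  in an open set of measure less than \<open>\<delta>\<close> around \<open>N\<close>. The intervals of the second kind form a
  division of short total length, so absolute continuity makes their contribution small as well.
\<close>

lemma absolutely_continuous_on_zero_derivative: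
  assumes ab: "a \<le> b" and f: "absolutely_continuous_on {a..b} f"
    and N: "negligible N"
    and d: "\<And>t. t \<in> {a..b} - N \<Longrightarrow> (f has_real_derivative 0) (at t within {a..b})"
  shows "f b = f a"
proof -
  have "\<bar>f b - f a\<bar> \<le> \<epsilon>" if eps: "\<epsilon> > 0" for \<epsilon>
  proof -
    define \<eta> where "\<eta> = \<epsilon> / (2 * (b - a + 1))"
    have \<eta>: "\<eta> > 0" and eb: "\<eta> * (b - a) \<le> \<epsilon> / 2"
      using eps ab by (auto simp: \<eta>_def field_simps)
    obtain \<delta> where \<delta>: "\<delta> > 0" "\<And>D T. D division_of T \<and> T \<subseteq> {a..b} \<and> (\<Sum>k\<in>D. Sup k - Inf k) < \<delta>
        \<Longrightarrow> (\<Sum>k\<in>D. \<bar>f (Sup k) - f (Inf k)\<bar>) < \<epsilon> / 2"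
      using f half_gt_zero[OF eps] unfolding absolutely_continuous_on_def by metis
    obtain U where U: "open U" "N \<subseteq> U" "U - N \<in> lmeasurable" "emeasure lebesgue (U - N) < ennreal \<delta>"
      using sets_lebesgue_outer_open[OF negligible_imp_sets[OF N] \<delta>(1)] by metis
    have mU: "U \<in> lmeasurable" "measure lebesgue U < \<delta>"
    proof -
      have "U = (U - N) \<union> N" using U by auto
      then show "U \<in> lmeasurable" using U N
        by (metis fmeasurable.Un negligible_iff_measure)
      then have "measure lebesgue U = measure lebesgue (U - N)"
        using N by (simp add: measure_Diff_null_set negligible_iff_null_sets fmeasurableD)
      then show "measure lebesgue U < \<delta>" using U(3,4)
        by (simp add: emeasure_eq_measure2 ennreal_less_iff)
    qed
    have "\<exists>r>0. \<forall>y\<in>{a..b}. \<bar>y - t\<bar> < r \<longrightarrow> \<bar>f y - f t\<bar> \<le> \<eta> * \<bar>y - t\<bar>" if "t \<in> {a..b} - N" for t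
    proof -
      have "(f has_derivative (\<lambda>h. 0)) (at t within {a..b})"
        using d[OF that] unfolding has_field_derivative_def by (simp only: mult_zero_left[abs_def])
      then show ?thesis using \<eta> unfolding has_derivative_within_alt by force
    qed
    then obtain r where r: "\<And>t. t \<in> {a..b} - N \<Longrightarrow> r t > 0"
      "\<And>t y. t \<in> {a..b} - N \<Longrightarrow> y \<in> {a..b} \<Longrightarrow> \<bar>y - t\<bar> < r t \<Longrightarrow> \<bar>f y - f t\<bar> \<le> \<eta> * \<bar>y - t\<bar>"
      by metis
    define \<gamma> where "\<gamma> t = (if t \<in> N then U else if t \<in> {a..b} then ball t (r t) else ball t 1)" for t
    have "gauge \<gamma>" unfolding gauge_def \<gamma>_def using U r by auto
    then obtain P where P: "P tagged_division_of {a..b}" "\<gamma> fine P"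
      using fine_division_exists_real by blast
    have finP: "finite P" using P by blast
    define B where "B = {(x, K) \<in> P. x \<in> N}"
    have BP: "B \<subseteq> P" unfolding B_def by auto
    have int: "\<exists>u v. K = {u..v} \<and> u \<le> x \<and> x \<le> v \<and> a \<le> u \<and> v \<le> b" if xK: "(x, K) \<in> P" for x K
    proof -
      obtain u v where "K = cbox u v" using tagged_division_ofD(4)[OF P(1) xK] by blast
      moreover have "x \<in> K" "K \<subseteq> {a..b}"
        using tagged_division_ofD(2,3)[OF P(1) xK] by auto
      ultimately show ?thesis by auto
    qed
    have good: "\<bar>f (Sup K) - f (Inf K)\<bar> \<le> \<eta> * (Sup K - Inf K)" if xK: "(x, K) \<in> P - B" for x K
    proof -
      obtain u v where uv: "K = {u..v}" "u \<le> x" "x \<le> v" "a \<le> u" "v \<le> b" using int xK by blast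
      have xN: "x \<in> {a..b} - N" using xK uv unfolding B_def by auto
      have "K \<subseteq> ball x (r x)" using P(2) xK xN unfolding fine_def \<gamma>_def by force
      moreover have "u \<in> K" "v \<in> K" using uv by auto
      ultimately have "\<bar>u - x\<bar> < r x" "\<bar>v - x\<bar> < r x"
        by (auto simp: subset_iff dist_real_def abs_minus_commute)
      then have "\<bar>f u - f x\<bar> \<le> \<eta> * \<bar>u - x\<bar>" "\<bar>f v - f x\<bar> \<le> \<eta> * \<bar>v - x\<bar>"
        using r(2)[OF xN, of u] r(2)[OF xN, of v] uv by simp_all
      then have "\<bar>f v - f u\<bar> \<le> \<eta> * (x - u) + \<eta> * (v - x)" using uv by simp
      then show ?thesis using uv by (simp add: algebra_simps)
    qed
    have lenP: "(\<Sum>(x,K)\<in>P. Sup K - Inf K) = b - a"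
      using additive_tagged_division_1[OF ab P(1), of "\<lambda>x. x"] by simp
    have goodsum: "(\<Sum>(x,K)\<in>P - B. \<bar>f (Sup K) - f (Inf K)\<bar>) \<le> \<epsilon> / 2"
    proof -
      have "(\<Sum>(x,K)\<in>P - B. \<bar>f (Sup K) - f (Inf K)\<bar>) \<le> (\<Sum>(x,K)\<in>P - B. \<eta> * (Sup K - Inf K))"
        using good by (intro sum_mono) auto
      also have "\<dots> \<le> (\<Sum>(x,K)\<in>P. \<eta> * (Sup K - Inf K))"
      proof (rule sum_mono2)
        fix z assume "z \<in> P - (P - B)"
        then have "(fst z, snd z) \<in> P" by simp
        then obtain u v where "z = (fst z, {u..v})" "u \<le> v"
          using int[of "fst z" "snd z"] by (metis order_trans prod.collapse)
        then show "0 \<le> (case z of (x, K) \<Rightarrow> \<eta> * (Sup K - Inf K))" using \<eta>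
          by (metis (no_types, lifting) case_prod_conv cInf_atLeastAtMost cSup_atLeastAtMost diff_ge_0_iff_ge mult_nonneg_nonneg order_less_imp_le)
      qed (use finP in auto)
      also have "\<dots> = \<eta> * (\<Sum>(x,K)\<in>P. Sup K - Inf K)"
        by (simp add: sum_distrib_left split_def)
      also have "\<dots> = \<eta> * (b - a)" using lenP by simp
      finally show ?thesis using eb by simp
    qed
    have Btag: "B tagged_division_of \<Union> (snd ` B)"
      using P(1) BP by (meson tagged_division_of_def tagged_partial_division_of_Union_self tagged_partial_division_subset)
    have Bdiv: "snd ` B division_of \<Union> (snd ` B)" using division_of_tagged_division[OF Btag] .
    have Bsub: "\<Union> (snd ` B) \<subseteq> {a..b}" using P(1) BP by fastforce
    have BU: "\<Union> (snd ` B) \<subseteq> U" using P(2) unfolding B_def fine_def \<gamma>_def by fastforce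
    have "(\<Sum>K\<in>snd ` B. Sup K - Inf K) = (\<Sum>K\<in>snd ` B. measure lebesgue K)"
    proof (rule sum.cong)
      fix K assume "K \<in> snd ` B"
      then obtain x where "(x, K) \<in> P" using BP by auto
      then obtain u v where "K = {u..v}" "u \<le> x" "x \<le> v" using int[of x K] by blast
      then show "Sup K - Inf K = measure lebesgue K" by simp
    qed simp
    also have "\<dots> = measure lebesgue (\<Union> (snd ` B))" using Bdiv by (simp add: content_division)
    also have "\<dots> \<le> measure lebesgue U"
      using BU mU fmeasurableD[OF lmeasurable_division[OF Bdiv]]
      by (intro measure_mono_fmeasurable) auto
    finally have "(\<Sum>K\<in>snd ` B. \<bar>f (Sup K) - f (Inf K)\<bar>) < \<epsilon> / 2"
      using \<delta>(2)[of "snd ` B"] Bdiv Bsub mU by auto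
    moreover have "(\<Sum>(x,K)\<in>B. \<bar>f (Sup K) - f (Inf K)\<bar>) = (\<Sum>K\<in>snd ` B. \<bar>f (Sup K) - f (Inf K)\<bar>)"
    proof -
      \<comment> \<open>The summand has to vanish on the empty box as well, where \<open>Inf\<close> and \<open>Sup\<close> are unspecified.\<close>
      let ?d = "\<lambda>K. if K = {} then 0 else \<bar>f (Sup K) - f (Inf K)\<bar>"
      have "(\<Sum>(x,K)\<in>B. ?d K) = sum ?d (snd ` B)"
      proof (rule sum.over_tagged_division_lemma[OF Btag])
        fix u v :: real assume "box u v = {}"
        then show "?d (cbox u v) = 0" by (cases "u = v") auto
      qed
      moreover have "K \<noteq> {}" if "(x, K) \<in> B" for x K
        using tagged_division_ofD(2)[OF Btag that] by auto
      then have "(\<Sum>(x,K)\<in>B. ?d K) = (\<Sum>(x,K)\<in>B. \<bar>f (Sup K) - f (Inf K)\<bar>)"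
        "sum ?d (snd ` B) = (\<Sum>K\<in>snd ` B. \<bar>f (Sup K) - f (Inf K)\<bar>)"
        by (auto intro!: sum.cong)
      ultimately show ?thesis by simp
    qed
    ultimately have badsum: "(\<Sum>(x,K)\<in>B. \<bar>f (Sup K) - f (Inf K)\<bar>) \<le> \<epsilon> / 2" by simp
    have "\<bar>f b - f a\<bar> = \<bar>\<Sum>(x,K)\<in>P. f (Sup K) - f (Inf K)\<bar>"
      using additive_tagged_division_1[OF ab P(1), of f] by simp
    also have "\<dots> \<le> (\<Sum>(x,K)\<in>P. \<bar>f (Sup K) - f (Inf K)\<bar>)"
      unfolding split_def by (rule sum_abs)
    also have "\<dots> = (\<Sum>(x,K)\<in>P - B. \<bar>f (Sup K) - f (Inf K)\<bar>) + (\<Sum>(x,K)\<in>B. \<bar>f (Sup K) - f (Inf K)\<bar>)"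
      using sum.subset_diff[OF BP finP] by blast
    finally show ?thesis using goodsum badsum by simp
  qed
  then have "\<bar>f b - f a\<bar> \<le> 0" using field_le_epsilon[of "\<bar>f b - f a\<bar>" 0] by simp
  then show ?thesis by simp
qed

text \<open>
  Lebesgue's differentiation theorem, in two-sided form. Averages over the intervals to the right of
  a point converge a.e. for \<open>f\<close> and for its reflection, and the latter are the averages of \<open>f\<close> to the
  left.
\<close>

lemma has_real_derivative_indefinite_integral_AE:
  fixes f :: "real \<Rightarrow> real"
  assumes f: "f integrable_on {a..b}"
  obtains N where "negligible N"
    "\<And>t. t \<in> {a..b} - N \<Longrightarrow> ((\<lambda>t. integral {a..t} f) has_real_derivative f t) (at t within {a..b})"
proof -
  define g where "g t = (if t \<in> {a..b} then f t else 0)" for t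
  have gU: "g integrable_on UNIV" using f integrable_restrict_UNIV[of "{a..b}" f] unfolding g_def by simp
  have gi: "g integrable_on cbox u v" for u v
    using gU integrable_on_subcbox by blast
  have g'i: "(\<lambda>t. g (- t)) integrable_on cbox u v" for u v
    using gi[of "-v" "-u"] Henstock_Kurzweil_Integration.integrable_reflect_real[of g "-u" "-v"] by simp
  obtain N1 where N1: "negligible N1" "\<And>x e. x \<notin> N1 \<Longrightarrow> 0 < e \<Longrightarrow>
      \<exists>d>0. \<forall>h. 0 < h \<and> h < d \<longrightarrow> norm (integral (cbox x (x + h *\<^sub>R One)) g /\<^sub>R h ^ DIM(real) - g x) < e"
    using integrable_ccontinuous_explicit[of g, OF gi] by metis
  obtain N2 where N2: "negligible N2" "\<And>x e. x \<notin> N2 \<Longrightarrow> 0 < e \<Longrightarrow>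
      \<exists>d>0. \<forall>h. 0 < h \<and> h < d \<longrightarrow> norm (integral (cbox x (x + h *\<^sub>R One)) (\<lambda>t. g (- t)) /\<^sub>R h ^ DIM(real) - g (- x)) < e"
    using integrable_ccontinuous_explicit[of "\<lambda>t. g (- t)", OF g'i] by metis
  have negl: "negligible (N1 \<union> uminus ` N2)"
    using N1(1) N2(1) negligible_differentiable_image_negligible[of N2 uminus]
    by (intro negligible_Un) (auto intro!: derivative_intros differentiable_on_minus differentiable_on_id)
  have "((\<lambda>t. integral {a..t} f) has_real_derivative f t) (at t within {a..b})"
    if t: "t \<in> {a..b} - (N1 \<union> uminus ` N2)" for t
  proof -
    have tN: "t \<notin> N1" "- t \<notin> N2" using t by (auto simp: image_iff)
    have lim: "\<exists>d>0. \<forall>y\<in>{a..b}. \<bar>y - t\<bar> < d \<longrightarrow>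
        \<bar>integral {a..y} f - integral {a..t} f - f t * (y - t)\<bar> \<le> e * \<bar>y - t\<bar>" if e: "e > 0" for e
    proof -
      obtain d1 where d1: "d1 > 0" "\<And>h. 0 < h \<Longrightarrow> h < d1 \<Longrightarrow> \<bar>integral {t..t + h} g / h - g t\<bar> < e"
        using N1(2)[OF tN(1) e] by (auto simp: divide_inverse_commute)
      obtain d2 where d2: "d2 > 0" "\<And>h. 0 < h \<Longrightarrow> h < d2 \<Longrightarrow> \<bar>integral {-t..-t + h} (\<lambda>s. g (- s)) / h - g t\<bar> < e"
        using N2(2)[OF tN(2) e] by (auto simp: divide_inverse_commute)
      have gt: "g t = f t" using t by (simp add: g_def)
      have split: "integral {a..v} f - integral {a..u} f = integral {u..v} g"
        if "u \<in> {a..b}" "v \<in> {a..b}" "u \<le> v" for u v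
      proof -
        have "f integrable_on {a..v}" using f integrable_on_subinterval that by fastforce
        then have "integral {a..u} f + integral {u..v} f = integral {a..v} f"
          using that by (intro Henstock_Kurzweil_Integration.integral_combine) auto
        moreover have "integral {u..v} f = integral {u..v} g"
          using that by (intro integral_cong) (auto simp: g_def)
        ultimately show ?thesis by simp
      qed
      have "\<bar>integral {a..y} f - integral {a..t} f - f t * (y - t)\<bar> \<le> e * \<bar>y - t\<bar>"
        if y: "y \<in> {a..b}" "\<bar>y - t\<bar> < min d1 d2" for y
      proof (cases y t rule: linorder_cases)
        case greater
        then have "\<bar>integral {t..y} g / (y - t) - f t\<bar> < e" using d1(2)[of "y - t"] y gt by simp
        then have "\<bar>integral {t..y} g - f t * (y - t)\<bar> \<le> e * (y - t)"
          using greater by (simp add: field_simps abs_if split: if_splits)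
        then show ?thesis using split[of t y] t y greater by simp
      next
        case less
        have "integral {-t..-y} (\<lambda>s. g (- s)) = integral {y..t} g"
          by (rule Henstock_Kurzweil_Integration.integral_reflect_real)
        then have "\<bar>integral {y..t} g / (t - y) - f t\<bar> < e" using d2(2)[of "t - y"] y gt less by simp
        then have "\<bar>integral {y..t} g - f t * (t - y)\<bar> \<le> e * (t - y)"
          using less by (simp add: field_simps abs_if split: if_splits)
        moreover have "integral {a..y} f - integral {a..t} f - f t * (y - t) = - (integral {y..t} g - f t * (t - y))"
          using split[of y t] t y less by (simp add: algebra_simps)
        ultimately show ?thesis using less by (simp only: abs_minus_cancel) simp
      qed simp
      then show ?thesis using d1(1) d2(1) by (intro exI[of _ "min d1 d2"]) auto
    qed
    show ?thesis unfolding has_field_derivative_def has_derivative_within_alt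
      using lim by (auto simp: bounded_linear_mult_right)
  qed
  then show thesis using negl that by blast
qed

lemma lipschitz_onI_bounded_derivative:
  fixes f f' :: "real \<Rightarrow> real"
  assumes "\<And>t. (f has_real_derivative f' t) (at t within {a..b})"
    and "\<And>t. t \<in> {a..b} \<Longrightarrow> \<bar>f' t\<bar> \<le> C" and "0 \<le> C"
  shows "C-lipschitz_on {a..b} f"
proof (rule lipschitz_onI)
  fix x y assume "x \<in> {a..b}" "y \<in> {a..b}"
  then show "dist (f x) (f y) \<le> C * dist x y"
    using field_differentiable_bound[of "{a..b}" f f' C x y] assms
    by (simp add: dist_norm)
qed (rule assms)

lemma AE_lebesgue_on_iff_negligible:
  fixes a b :: real
  shows "(AE t in lebesgue_on {a..b}. P t) \<longleftrightarrow> negligible {t\<in>{a..b}. \<not> P t}"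
proof -
  have "(AE t in lebesgue_on {a..b}. P t) \<longleftrightarrow> (AE t in lebesgue. t \<in> {a..b} \<longrightarrow> P t)"
    by (simp add: AE_restrict_space_iff)
  also have "\<dots> \<longleftrightarrow> negligible {t\<in>{a..b}. \<not> P t}"
    by (simp add: completion.AE_iff_null_sets negligible_iff_null_sets)
  finally show ?thesis .
qed

lemma negligible_affine_vimage:
  fixes r c :: real
  assumes "negligible N" "r \<noteq> 0"
  shows "negligible {t. c + r * t \<in> N}"
proof -
  have "negligible ((\<lambda>s. (s - c) / r) ` N)"
    using assms by (intro negligible_differentiable_image_negligible)
      (auto intro!: derivative_intros simp: differentiable_on_def)
  moreover have "{t. c + r * t \<in> N} = (\<lambda>s. (s - c) / r) ` N"
    using assms(2) by (force simp: image_iff)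
  ultimately show ?thesis by simp
qed

section \<open>The logarithmic mean and the action\<close>

lemma continuous_on_log_mean_integrand:
  fixes u v :: real
  assumes "0 < u" "0 < v"
  shows "continuous_on {0..1} (\<lambda>\<xi>. u powr \<xi> * v powr (1 - \<xi>))"
  using assms by (intro continuous_intros) auto

lemma log_mean_mono:
  assumes "0 \<le> u" "u \<le> u'" "0 \<le> v" "v \<le> v'"
  shows "log_mean u v \<le> log_mean u' v'"
proof (cases "u = 0 \<or> v = 0")
  case True
  have "0 \<le> log_mean u' v'" unfolding log_mean_def
    by (cases "(\<lambda>\<xi>. u' powr \<xi> * v' powr (1 - \<xi>)) integrable_on {0..1}")
       (auto intro!: integral_nonneg simp: not_integrable_integral)
  then show ?thesis using True by auto
next
  case False
  then have "0 < u" "0 < v" "0 < u'" "0 < v'" using assms by auto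
  then show ?thesis unfolding log_mean_def using assms
    by (intro integral_le integrable_continuous_real continuous_on_log_mean_integrand)
       (auto intro!: mult_mono powr_mono2)
qed

lemma log_mean_ge_min:
  assumes "0 \<le> m" "m \<le> u" "m \<le> v"
  shows "m \<le> log_mean u v"
  using log_mean_mono[of m u m v] log_mean_same[of m] assms by simp

lemma log_mean_nonneg: "0 \<le> u \<Longrightarrow> 0 \<le> v \<Longrightarrow> 0 \<le> log_mean u v"
  using log_mean_ge_min[of 0 u v] by simp

lemma log_mean_mult:
  assumes "0 \<le> c" "0 \<le> u" "0 \<le> v"
  shows "log_mean (c * u) (c * v) = c * log_mean u v"
proof (cases "c = 0")
  case False
  then have "(c * u) powr \<xi> * (c * v) powr (1 - \<xi>) = c * (u powr \<xi> * v powr (1 - \<xi>))" for \<xi>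
  proof -
    have "(c * u) powr \<xi> * (c * v) powr (1 - \<xi>) = (c powr \<xi> * c powr (1 - \<xi>)) * (u powr \<xi> * v powr (1 - \<xi>))"
      using assms by (simp add: powr_mult)
    also have "c powr \<xi> * c powr (1 - \<xi>) = c" using assms False by (simp flip: powr_add)
    finally show ?thesis .
  qed
  then show ?thesis unfolding log_mean_def by simp
qed simp

text \<open>
  Read off from the closed form of the logarithmic mean, which avoids integrals depending on a
  parameter.
\<close>

lemma borel_measurable_log_mean:
  assumes [measurable]: "f \<in> borel_measurable M" "g \<in> borel_measurable M"
    and nonneg: "\<And>x. x \<in> space M \<Longrightarrow> 0 \<le> f x" "\<And>x. x \<in> space M \<Longrightarrow> 0 \<le> g x"
  shows "(\<lambda>x. log_mean (f x) (g x)) \<in> borel_measurable M"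
proof -
  have "(\<lambda>x. if f x = 0 \<or> g x = 0 then 0 else if f x = g x then f x
      else (f x - g x) / (ln (f x) - ln (g x))) \<in> borel_measurable M"
    by measurable
  moreover have "log_mean (f x) (g x) = (if f x = 0 \<or> g x = 0 then 0 else if f x = g x then f x
      else (f x - g x) / (ln (f x) - ln (g x)))" if "x \<in> space M" for x
    using nonneg[OF that] by (auto simp: log_mean_same log_mean_diff)
  ultimately show ?thesis by (simp cong: measurable_cong)
qed

lemma borel_measurable_action_density:
  assumes [measurable]: "v \<in> borel_measurable M" "f \<in> borel_measurable M" "g \<in> borel_measurable M"
    and nonneg: "\<And>x. x \<in> space M \<Longrightarrow> 0 \<le> f x" "\<And>x. x \<in> space M \<Longrightarrow> 0 \<le> g x"
  shows "(\<lambda>x. action_density (v x) (f x) (g x)) \<in> borel_measurable M"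
proof -
  note [measurable] = borel_measurable_log_mean[OF assms(2,3) nonneg]
  show ?thesis unfolding action_density_def by measurable
qed

lemma borel_measurable_flux_action:
  assumes "\<And>x. (\<lambda>t. \<mu> t x) \<in> borel_measurable M" "\<And>x y. (\<lambda>t. V t x y) \<in> borel_measurable M"
    and "\<And>t x. t \<in> space M \<Longrightarrow> 0 \<le> \<mu> t x"
  shows "(\<lambda>t. flux_action K \<pi> (\<mu> t) (V t)) \<in> borel_measurable M"
proof -
  have [measurable]: "(\<lambda>t. action_density (V t x y) (\<mu> t x) (\<mu> t y)) \<in> borel_measurable M" for x y
    using assms by (intro borel_measurable_action_density) auto
  show ?thesis unfolding flux_action_def by measurable
qed

text \<open>
  Increasing both densities at least by the factor \<open>c\<close> increases the logarithmic mean at least by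
  \<open>c\<close>, hence decreases the action at least by \<open>c\<close>. This multiplicative form covers infinite
  actions and takes the place of differentiating or using concavity of the mean.
\<close>

lemma action_density_scale:
  assumes c: "1 \<le> c" and "0 \<le> u" "c * u \<le> u'" "0 \<le> w" "c * w \<le> w'"
  shows "ennreal c * action_density v u' w' \<le> action_density v u w"
proof (cases "log_mean u w = 0")
  case True
  then show ?thesis by (auto simp: action_density_def)
next
  case False
  then have pos: "0 < log_mean u w" using assms log_mean_nonneg[of u w] by simp
  have "c * log_mean u w = log_mean (c * u) (c * w)" using assms by (simp add: log_mean_mult)
  also have "\<dots> \<le> log_mean u' w'" using assms by (intro log_mean_mono) auto
  finally have le: "c * log_mean u w \<le> log_mean u' w'" .
  moreover have cpos: "0 < c * log_mean u w" using pos c by simp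
  ultimately have pos': "0 < log_mean u' w'" by linarith
  have "c * (v\<^sup>2 / log_mean u' w') \<le> c * (v\<^sup>2 / (c * log_mean u w))"
    using le pos' cpos c by (intro mult_left_mono divide_left_mono) auto
  also have "\<dots> = v\<^sup>2 / log_mean u w" using c by simp
  finally show ?thesis using pos pos' c
    by (simp add: action_density_def ennreal_mult'[symmetric] ennreal_leI)
qed

lemma flux_action_scale:
  assumes c: "1 \<le> c" and "\<And>x. 0 \<le> \<mu> x" "\<And>x. c * \<mu> x \<le> \<nu> x"
  shows "ennreal c * flux_action K \<pi> \<nu> V \<le> flux_action K \<pi> \<mu> V"
proof -
  have "ennreal c * flux_action K \<pi> \<nu> V = ennreal (1/2) * (\<Sum>x\<in>UNIV. \<Sum>y\<in>UNIV.
      ennreal c * action_density (V x y) (\<nu> x) (\<nu> y) * ennreal (K x y) * ennreal (\<pi> x))"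
    unfolding flux_action_def by (simp add: sum_distrib_left mult_ac)
  also have "\<dots> \<le> flux_action K \<pi> \<mu> V"
    unfolding flux_action_def using assms
    by (intro mult_left_mono sum_mono mult_right_mono action_density_scale) auto
  finally show ?thesis .
qed

lemma action_density_mult: "action_density (c * v) s t = ennreal (c\<^sup>2) * action_density v s t"
  if "c \<noteq> 0"
  using that by (auto simp: action_density_def ennreal_mult_top power_mult_distrib ennreal_mult'[symmetric])

lemma flux_action_mult:
  assumes "c \<noteq> 0"
  shows "flux_action K \<pi> \<mu> (\<lambda>x y. c * V x y) = ennreal (c\<^sup>2) * flux_action K \<pi> \<mu> V"
  using assms unfolding flux_action_def by (simp add: action_density_mult sum_distrib_left mult_ac)

lemma flux_action_eq_0D:
  assumes "flux_action K \<pi> \<mu> V = 0" and "\<And>x. 0 \<le> \<mu> x" and "0 < K x y" "0 < \<pi> x"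
  shows "V x y = 0"
proof -
  have "action_density (V x y) (\<mu> x) (\<mu> y) * ennreal (K x y) * ennreal (\<pi> x) = 0"
    using assms(1) by (simp add: flux_action_def sum_nonneg_eq_0_iff)
  then have "action_density (V x y) (\<mu> x) (\<mu> y) = 0" using assms(3,4) by simp
  then show ?thesis using log_mean_nonneg[of "\<mu> x" "\<mu> y"] assms(2)
    by (auto simp: action_density_def divide_le_0_iff ennreal_eq_0_iff split: if_splits)
qed

text \<open>
  The right-hand side does not mention \<open>\<mu>\<close>: whether a flux is free of cost can be tested at any
  density.
\<close>

lemma flux_action_eq_0_iff:
  assumes "\<And>x. 0 \<le> \<mu> x" and K: "\<And>x y. 0 \<le> K x y" and \<pi>: "\<And>x. 0 < \<pi> x"
  shows "flux_action K \<pi> \<mu> V = 0 \<longleftrightarrow> (\<forall>x y. 0 < K x y \<longrightarrow> V x y = 0)"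
proof
  assume "flux_action K \<pi> \<mu> V = 0"
  then show "\<forall>x y. 0 < K x y \<longrightarrow> V x y = 0" using flux_action_eq_0D assms by metis
next
  assume V: "\<forall>x y. 0 < K x y \<longrightarrow> V x y = 0"
  have "action_density (V x y) (\<mu> x) (\<mu> y) * ennreal (K x y) * ennreal (\<pi> x) = 0" for x y
  proof (cases "0 < K x y")
    case False
    then have "K x y = 0" using K[of x y] by simp
    then show ?thesis by simp
  qed (use V in \<open>simp add: action_density_def\<close>)
  then show "flux_action K \<pi> \<mu> V = 0" unfolding flux_action_def by simp
qed

section \<open>The divergence of an irreducible kernel\<close>

lemma divergence_eq_0:
  assumes "\<And>x y. 0 < K x y \<Longrightarrow> V x y = 0 \<and> V y x = 0" and "\<And>x y. 0 \<le> K x y"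
  shows "divergence K V x = 0"
proof -
  have "(V x y - V y x) * K x y = 0" for y
    using assms(1)[of x y] assms(2)[of x y] by force
  then show ?thesis unfolding divergence_def by (simp only: sum.neutral_const)
qed

lemma divergence_mult: "divergence K (\<lambda>x y. c * V x y) x = c * divergence K V x"
  unfolding divergence_def by (simp add: sum_distrib_left algebra_simps)

lemma divergence_add: "divergence K (\<lambda>x y. V x y + W x y) x = divergence K V x + divergence K W x"
  unfolding divergence_def by (simp add: sum.distrib[symmetric] algebra_simps)

lemma divergence_sum: "finite I \<Longrightarrow>
    divergence K (\<lambda>x y. \<Sum>i\<in>I. W i x y) x = (\<Sum>i\<in>I. divergence K (W i) x)"
  by (induction rule: finite_induct) (simp_all add: divergence_add, simp add: divergence_def)

lemma kernel_pow_pos_imp_rtrancl: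
  assumes K: "\<And>x y. 0 \<le> K x y" and pos: "0 < kernel_pow K n x y"
  shows "(x, y) \<in> {(x, y). 0 < K x y}\<^sup>*"
proof -
  have nn: "0 \<le> kernel_pow K n x y" for n x y
    using K by (induction n arbitrary: x) (auto intro!: sum_nonneg)
  show ?thesis using pos
  proof (induction n arbitrary: x)
    case (Suc n)
    have "\<exists>z. 0 < K x z * kernel_pow K n z y"
    proof (rule ccontr)
      assume "\<nexists>z. 0 < K x z * kernel_pow K n z y"
      then have "kernel_pow K (Suc n) x y \<le> 0"
        unfolding kernel_pow.simps by (intro sum_nonpos) (simp add: not_less)
      with Suc.prems show False by simp
    qed
    then obtain z where "0 < K x z * kernel_pow K n z y" by blast
    then have "0 < K x z" "0 < kernel_pow K n z y"
      using K[of x z] nn[of n z y] by (auto simp: zero_less_mult_iff)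
    then show ?case using Suc.IH[of z] by (auto intro: converse_rtrancl_into_rtrancl)
  qed (auto split: if_splits)
qed

lemma irreducible_kernel_rtrancl:
  assumes "markov_kernel K" "irreducible_kernel K"
  shows "(x, y) \<in> {(x, y). 0 < K x y}\<^sup>*"
proof -
  obtain n where "0 < kernel_pow K n x y"
    using assms(2) unfolding irreducible_kernel_def by blast
  then show ?thesis
    using assms(1) by (intro kernel_pow_pos_imp_rtrancl) (auto simp: markov_kernel_def)
qed

text \<open>
  Some state has positive mass, and invariance transports positive mass along the edges of \<open>K\<close>.
\<close>

lemma invariant_probability_pos:
  assumes K: "markov_kernel K" "irreducible_kernel K" and \<pi>: "invariant_probability K \<pi>"
  shows "0 < \<pi> x"
proof -
  have nn: "0 \<le> \<pi> x" "0 \<le> K x y" for x y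
    using K \<pi> unfolding markov_kernel_def invariant_probability_def by blast+
  have "(\<Sum>y\<in>UNIV. \<pi> y) = 1" using \<pi> unfolding invariant_probability_def by blast
  have "\<exists>y. \<pi> y \<noteq> 0"
  proof (rule ccontr)
    assume "\<nexists>y. \<pi> y \<noteq> 0"
    then show False using \<open>(\<Sum>y\<in>UNIV. \<pi> y) = 1\<close> by simp
  qed
  then obtain y where "\<pi> y \<noteq> 0" by blast
  then have y: "0 < \<pi> y" using nn(1)[of y] by simp
  have "(y, x) \<in> {(x, y). 0 < K x y}\<^sup>*" by (rule irreducible_kernel_rtrancl[OF K])
  then show ?thesis
  proof (induction rule: rtrancl_induct)
    case (step z w)
    have "0 < \<pi> z * K z w" using step by simp
    also have "\<dots> \<le> (\<Sum>z\<in>UNIV. \<pi> z * K z w)"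
      using nn by (intro member_le_sum) auto
    also have "\<dots> = \<pi> w" using \<pi> unfolding invariant_probability_def by metis
    finally show ?case .
  qed (rule y)
qed

text \<open>
  A flux on one edge from \<open>u\<close> to \<open>v\<close> produces the difference \<open>D u v\<close> of the unit masses at \<open>u\<close> and
  \<open>v\<close>, as densities with respect to \<open>\<pi>\<close>. Adding up the fluxes along a path gives \<open>D u v\<close> for
  arbitrary \<open>u\<close> and \<open>v\<close> because \<open>K\<close> is irreducible, and every \<open>f\<close> of mean zero is a combination
  of the \<open>D u o'\<close> with \<open>o'\<close> fixed.
\<close>

lemma ex_divergence_eq:
  fixes K :: "'a::finite \<Rightarrow> 'a \<Rightarrow> real"
  assumes K: "markov_kernel K" "irreducible_kernel K" and \<pi>: "invariant_probability K \<pi>"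
    and rev: "reversible_kernel K \<pi>" and mean: "(\<Sum>x\<in>UNIV. f x * \<pi> x) = 0"
  obtains W where "\<And>x. divergence K W x = f x"
proof -
  have \<pi>pos: "0 < \<pi> x" for x using invariant_probability_pos[OF K \<pi>] .
  define D where "D u v z = of_bool (z = u) / \<pi> u - of_bool (z = v) / \<pi> v" for u v z :: 'a
  have edge: "\<exists>W. \<forall>z. divergence K W z = D u v z" if uv: "0 < K u v" for u v
  proof
    \<comment> \<open>The factor 2 cancels the one half in the divergence; reversibility gives the same mass at both ends.\<close>
    let ?W = "\<lambda>x y. of_bool (x = u \<and> y = v) * (2 / (K u v * \<pi> u))"
    have vu: "K v u * \<pi> v = K u v * \<pi> u" using rev unfolding reversible_kernel_def by auto
    have "(\<Sum>y\<in>UNIV. (?W z y - ?W y z) * K z y) = 2 * D u v z" for z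
    proof -
      have "(\<Sum>y\<in>UNIV. (?W z y - ?W y z) * K z y) =
        (\<Sum>y\<in>UNIV. if y = v then of_bool (z = u) * (2 / (K u v * \<pi> u)) * K u v else 0) -
        (\<Sum>y\<in>UNIV. if y = u then of_bool (z = v) * (2 / (K u v * \<pi> u)) * K v u else 0)"
        unfolding sum_subtractf[symmetric] by (intro sum.cong) (auto simp: algebra_simps)
      also have "\<dots> = of_bool (z = u) * (2 / (K u v * \<pi> u)) * K u v - of_bool (z = v) * (2 / (K v u * \<pi> v)) * K v u"
        unfolding vu by (simp only: sum.delta finite UNIV_I if_True)
      also have "K v u \<noteq> 0" using vu uv \<pi>pos[of u] by auto
      then have "of_bool (z = u) * (2 / (K u v * \<pi> u)) * K u v - of_bool (z = v) * (2 / (K v u * \<pi> v)) * K v u = 2 * D u v z"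
        using uv by (simp add: D_def field_simps)
      finally show ?thesis .
    qed
    then show "\<forall>z. divergence K ?W z = D u v z" by (simp add: divergence_def)
  qed
  have path: "\<exists>W. \<forall>z. divergence K W z = D u v z" for u v
    using irreducible_kernel_rtrancl[OF K, of u v]
  proof (induction rule: rtrancl_induct)
    case base
    have "\<forall>z. divergence K (\<lambda>x y. 0) z = D u u z" by (simp add: divergence_def D_def)
    then show ?case by blast
  next
    case (step v w)
    then obtain W1 W2 where "\<forall>z. divergence K W1 z = D u v z" "\<forall>z. divergence K W2 z = D v w z"
      using edge by blast
    then have "\<forall>z. divergence K (\<lambda>x y. W1 x y + W2 x y) z = D u w z"
      by (simp add: divergence_add D_def)
    then show ?case by blast
  qed
  obtain o' :: 'a where True by blast
  obtain W where W: "\<And>u z. divergence K (W u) z = D u o' z" using path[of _ o'] by metis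
  have "divergence K (\<lambda>x y. \<Sum>u\<in>UNIV. (f u * \<pi> u) * W u x y) z = f z" for z
  proof -
    have "divergence K (\<lambda>x y. \<Sum>u\<in>UNIV. (f u * \<pi> u) * W u x y) z = (\<Sum>u\<in>UNIV. f u * \<pi> u * D u o' z)"
      by (simp add: divergence_sum divergence_mult W)
    also have "\<dots> = (\<Sum>u\<in>UNIV. f u * of_bool (z = u)) - (\<Sum>u\<in>UNIV. f u * \<pi> u) * (of_bool (z = o') / \<pi> o')"
      unfolding sum_distrib_right sum_subtractf[symmetric] D_def
      using less_imp_neq[OF \<pi>pos] by (intro sum.cong) (auto simp: field_simps)
    also have "\<dots> = f z" using mean by simp
    finally show ?thesis .
  qed
  then show thesis using that by blast
qed

section \<open>Trajectories and their energy\<close>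

definition energy_density ::
    "real \<Rightarrow> real \<Rightarrow> ('a::finite \<Rightarrow> 'a \<Rightarrow> real) \<Rightarrow> ('a \<Rightarrow> real) \<Rightarrow> (real \<Rightarrow> 'a \<Rightarrow> real) \<Rightarrow>
      (real \<Rightarrow> 'a \<Rightarrow> 'a \<Rightarrow> real) \<Rightarrow> (real \<Rightarrow> real) \<Rightarrow> real \<Rightarrow> ennreal" where
  "energy_density a b K \<pi> \<mu> V h t =
     ennreal (a\<^sup>2) * ennreal (\<bar>h t\<bar>\<^sup>2) + ennreal (b\<^sup>2) * flux_action K \<pi> (\<mu> t) (V t)"

lemma CE_borel_measurable:
  assumes "(\<mu>, V, h) \<in> CE K p \<mu>0 \<mu>1"
  shows "(\<lambda>t. \<mu> t x) \<in> borel_measurable (lebesgue_on {0..1})"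
    and "(\<lambda>t. V t x y) \<in> borel_measurable (lebesgue_on {0..1})"
    and "h \<in> borel_measurable (lebesgue_on {0..1})"
    and "(\<lambda>t. flux_action K' \<pi> (\<mu> t) (V t)) \<in> borel_measurable (lebesgue_on {0..1})"
proof -
  show \<mu>: "(\<lambda>t. \<mu> t x) \<in> borel_measurable (lebesgue_on {0..1})" for x
    using assms unfolding CE_def
    by (auto intro!: continuous_imp_measurable_on_sets_lebesgue absolutely_continuous_on_imp_continuous_on)
  show V: "(\<lambda>t. V t x y) \<in> borel_measurable (lebesgue_on {0..1})" for x y
    using assms unfolding CE_def by auto
  show "h \<in> borel_measurable (lebesgue_on {0..1})"
    using assms unfolding CE_def by auto
  show "(\<lambda>t. flux_action K' \<pi> (\<mu> t) (V t)) \<in> borel_measurable (lebesgue_on {0..1})"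
    using assms by (intro borel_measurable_flux_action \<mu> V) (auto simp: CE_def densities_def)
qed

lemma CE_borel_measurable_energy_density:
  assumes "(\<mu>, V, h) \<in> CE K p \<mu>0 \<mu>1"
  shows "energy_density a b K' \<pi> \<mu> V h \<in> borel_measurable (lebesgue_on {0..1})"
proof -
  note [measurable] = CE_borel_measurable[OF assms]
  have "(\<lambda>t. energy_density a b K' \<pi> \<mu> V h t) \<in> borel_measurable (lebesgue_on {0..1})"
    unfolding energy_density_def by measurable
  then show ?thesis by simp
qed

lemma quad_energy_eq:
  assumes "(\<mu>, V, h) \<in> CE K p \<mu>0 \<mu>1"
  shows "quad_energy a b K' \<pi> (\<mu>, V, h) = (\<integral>\<^sup>+t. energy_density a b K' \<pi> \<mu> V h t \<partial>lebesgue_on {0..1})"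
proof -
  note [measurable] = CE_borel_measurable[OF assms]
  show ?thesis unfolding quad_energy_def energy_density_def
    by (simp add: nn_integral_add nn_integral_cmult)
qed

text \<open>
  Move from \<open>\<mu>0\<close> to \<open>\<mu>1\<close> along the segment, and meanwhile add the mass \<open>w t * p\<close> with
  \<open>w t = t * (1 - t)\<close>. This keeps the logarithmic means above \<open>w t * min p\<close>, even where \<open>\<mu>0\<close> or
  \<open>\<mu>1\<close> vanishes. The segment is run with speed \<open>6 * w t\<close>, which vanishes at both ends, so the action
  is of order \<open>(w t)\<^sup>2 / w t\<close> and bounded; running it with constant speed would give
  the divergent integral of \<open>1 / w t\<close>.
\<close>

lemma ex_finite_energy:
  fixes K :: "'a::finite \<Rightarrow> 'a \<Rightarrow> real"
  assumes K: "markov_kernel K" "irreducible_kernel K" and \<pi>: "invariant_probability K \<pi>"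
    and rev: "reversible_kernel K \<pi>"
    and p: "p \<in> pos_densities" "(\<Sum>x\<in>UNIV. p x * \<pi> x) = 1"
    and \<mu>01: "\<mu>0 \<in> densities" "\<mu>1 \<in> densities"
  obtains \<gamma> where "\<gamma> \<in> CE K p \<mu>0 \<mu>1" "quad_energy a b K \<pi> \<gamma> < \<infinity>"
proof -
  \<comment> \<open>The mass that the source has to supply; it makes the remaining transport problem balanced.\<close>
  define m where "m = (\<Sum>x\<in>UNIV. (\<mu>1 x - \<mu>0 x) * \<pi> x)"
  have "(\<Sum>x\<in>UNIV. (m * p x - (\<mu>1 x - \<mu>0 x)) * \<pi> x) = m * (\<Sum>x\<in>UNIV. p x * \<pi> x) - m"
    unfolding m_def sum_distrib_left sum_subtractf[symmetric] by (simp add: algebra_simps)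
  then obtain W where W: "\<And>x. divergence K W x = m * p x - (\<mu>1 x - \<mu>0 x)"
    using ex_divergence_eq[OF K \<pi> rev, of "\<lambda>x. m * p x - (\<mu>1 x - \<mu>0 x)"] p(2) by auto
  define w where "w t = t * (1 - t)" for t :: real
  \<comment> \<open>The primitive of \<open>6 * w\<close> that rises from 0 to 1.\<close>
  define s where "s t = 3 * t^2 - 2 * t^3" for t :: real
  define \<mu> where "\<mu> t x = (1 - s t) * \<mu>0 x + s t * \<mu>1 x + w t * p x" for t x
  define V where "V t x y = (6 * w t) * W x y" for t x y
  define h where "h t = 6 * w t * m + (1 - 2 * t)" for t
  have w: "0 \<le> w t" "w t \<le> 1" if "t \<in> {0..1}" for t
    using that by (auto simp: w_def mult_le_one)
  have s: "0 \<le> s t" "s t \<le> 1" if "t \<in> {0..1}" for t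
  proof -
    have "s t = t^2 * (3 - 2 * t)" "1 - s t = (1 - t)^2 * (1 + 2 * t)"
      by (simp_all add: s_def power2_eq_square power3_eq_cube algebra_simps)
    moreover have "0 \<le> t^2 * (3 - 2 * t)" "0 \<le> (1 - t)^2 * (1 + 2 * t)" using that by auto
    ultimately show "0 \<le> s t" "s t \<le> 1" by linarith+
  qed
  have d\<mu>: "((\<lambda>t. \<mu> t x) has_real_derivative 6 * w t * (\<mu>1 x - \<mu>0 x) + (1 - 2 * t) * p x) (at t within A)" for t x A
    unfolding \<mu>_def s_def w_def
    by (auto intro!: derivative_eq_intros simp: algebra_simps power2_eq_square)
  have ge: "w t * p x \<le> \<mu> t x" if "t \<in> {0..1}" for t x
    using s[OF that] \<mu>01 unfolding \<mu>_def densities_def by auto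
  have "(\<mu>, V, h) \<in> CE K p \<mu>0 \<mu>1"
    unfolding CE_def mem_Collect_eq prod.case
  proof (intro conjI allI ballI)
    fix t :: real assume "t \<in> {0..1}"
    then have "0 \<le> w t * p x" for x using w p(1) unfolding pos_densities_def
      by (auto intro!: mult_nonneg_nonneg simp: less_imp_le)
    then show "\<mu> t \<in> densities" using ge \<open>t \<in> {0..1}\<close> unfolding densities_def
      by (blast intro: order_trans)
  next
    fix x
    have "\<bar>6 * w t * (\<mu>1 x - \<mu>0 x) + (1 - 2 * t) * p x\<bar> \<le> 6 * \<bar>\<mu>1 x - \<mu>0 x\<bar> + \<bar>p x\<bar>"
      if "t \<in> {0..1}" for t
    proof -
      have "w t * \<bar>\<mu>1 x - \<mu>0 x\<bar> \<le> 1 * \<bar>\<mu>1 x - \<mu>0 x\<bar>" "\<bar>1 - 2 * t\<bar> * \<bar>p x\<bar> \<le> 1 * \<bar>p x\<bar>"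
        by (rule mult_right_mono; use w[OF that] that in auto)+
      then have "\<bar>6 * w t * (\<mu>1 x - \<mu>0 x)\<bar> \<le> 6 * \<bar>\<mu>1 x - \<mu>0 x\<bar>" "\<bar>(1 - 2 * t) * p x\<bar> \<le> \<bar>p x\<bar>"
        using w[OF that] by (auto simp: abs_mult)
      then show ?thesis by linarith
    qed
    then show "absolutely_continuous_on {0..1} (\<lambda>t. \<mu> t x)"
      by (intro absolutely_continuous_onI_lipschitz lipschitz_onI_bounded_derivative[OF d\<mu>]) auto
  next
    show "\<mu> 0 = \<mu>0" "\<mu> 1 = \<mu>1" by (auto simp: \<mu>_def s_def w_def)
  next
    fix x y
    have "continuous_on {0..1} (\<lambda>t. V t x y)" "continuous_on {0..1} h"
      unfolding V_def h_def w_def by (intro continuous_intros)+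
    then show "(\<lambda>t. V t x y) \<in> borel_measurable (lebesgue_on {0..1})" "h \<in> borel_measurable (lebesgue_on {0..1})"
      by (auto intro!: continuous_imp_measurable_on_sets_lebesgue)
  next
    have divV: "divergence K (V t) x = (6 * w t) * (m * p x - (\<mu>1 x - \<mu>0 x))" for t x
      by (simp only: V_def[abs_def] divergence_mult W)
    have "\<exists>d. ((\<lambda>s. \<mu> s x) has_real_derivative d) (at t within {0..1}) \<and>
        d + divergence K (V t) x = h t * p x" for t x
      by (intro exI conjI, rule d\<mu>) (simp add: divV h_def algebra_simps)
    then show "AE t in lebesgue_on {0..1}. \<forall>x. \<exists>d. ((\<lambda>s. \<mu> s x) has_real_derivative d) (at t within {0..1}) \<and>
        d + divergence K (V t) x = h t * p x" by simp
  qed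
  moreover have "quad_energy a b K \<pi> (\<mu>, V, h) < \<infinity>"
  proof -
    define q where "q = Min (range p)"
    have q: "0 < q" "\<And>x. q \<le> p x" using p(1) by (auto simp: q_def pos_densities_def)
    define C where "C = ennreal (1/2) * (\<Sum>x\<in>UNIV. \<Sum>y\<in>UNIV.
        ennreal (36 * (W x y)\<^sup>2 / q) * ennreal (K x y) * ennreal (\<pi> x))"
    have "action_density (V t x y) (\<mu> t x) (\<mu> t y) \<le> ennreal (36 * (W x y)\<^sup>2 / q)" if t: "t \<in> {0..1}" for t x y
    proof (cases "w t = 0")
      case True
      then show ?thesis by (simp add: action_density_def V_def)
    next
      case False
      then have wpos: "0 < w t" using w[OF t] by simp
      have "w t * q \<le> \<mu> t x" for x using ge[OF t, of x] mult_left_mono[OF q(2)[of x], of "w t"] wpos by linarith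
      then have lm: "w t * q \<le> log_mean (\<mu> t x) (\<mu> t y)" using wpos q(1) by (intro log_mean_ge_min) auto
      have wq: "0 < w t * q" using wpos q(1) by simp
      have "(V t x y)\<^sup>2 / log_mean (\<mu> t x) (\<mu> t y) \<le> (V t x y)\<^sup>2 / (w t * q)"
        using lm wq mult_pos_pos[OF less_le_trans[OF wq lm] wq] by (intro divide_left_mono) auto
      also have "\<dots> = w t * (36 * (W x y)\<^sup>2 / q)"
        using wpos by (simp add: V_def power2_eq_square field_simps)
      also have "\<dots> \<le> 1 * (36 * (W x y)\<^sup>2 / q)"
        using w[OF t] q(1) by (intro mult_right_mono) auto
      finally show ?thesis using lm wq by (auto simp: action_density_def ennreal_leI)
    qed
    then have 1: "flux_action K \<pi> (\<mu> t) (V t) \<le> C" if "t \<in> {0..1}" for t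
      unfolding flux_action_def C_def using that by (intro mult_left_mono sum_mono mult_right_mono) auto
    have 2: "ennreal (\<bar>h t\<bar>\<^sup>2) \<le> ennreal ((6 * \<bar>m\<bar> + 1)\<^sup>2)" if t: "t \<in> {0..1}" for t
    proof -
      have "w t * \<bar>m\<bar> \<le> 1 * \<bar>m\<bar>" using w[OF t] by (intro mult_right_mono) auto
      then have "\<bar>6 * w t * m\<bar> \<le> 6 * \<bar>m\<bar>" using w[OF t] by (simp add: abs_mult)
      then have "\<bar>h t\<bar> \<le> 6 * \<bar>m\<bar> + 1" using t unfolding h_def by auto
      then show ?thesis by (intro ennreal_leI power_mono) auto
    qed
    have le: "(\<integral>\<^sup>+t. f t \<partial>lebesgue_on {0..1}) \<le> D" if "\<And>t. t \<in> {0..1} \<Longrightarrow> f t \<le> D" for f :: "real \<Rightarrow> ennreal" and D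
    proof -
      have "(\<integral>\<^sup>+t. f t \<partial>lebesgue_on {0..1}) \<le> (\<integral>\<^sup>+t. D \<partial>lebesgue_on {0..1::real})"
        using that by (intro nn_integral_mono) auto
      then show ?thesis by (simp add: emeasure_restrict_space)
    qed
    have "(\<Sum>x\<in>UNIV. \<Sum>y\<in>UNIV. ennreal (36 * (W x y)\<^sup>2 / q) * ennreal (K x y) * ennreal (\<pi> x)) < top"
      by (simp add: ennreal_mult_less_top)
    then have "C < top"
      unfolding C_def ennreal_mult_less_top using ennreal_less_top by blast
    then have "ennreal (a\<^sup>2) * ennreal ((6 * \<bar>m\<bar> + 1)\<^sup>2) + ennreal (b\<^sup>2) * C < \<infinity>"
      by (simp add: ennreal_mult_less_top)
    moreover have "quad_energy a b K \<pi> (\<mu>, V, h) \<le> ennreal (a\<^sup>2) * ennreal ((6 * \<bar>m\<bar> + 1)\<^sup>2) + ennreal (b\<^sup>2) * C"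
      unfolding quad_energy_def prod.case by (intro add_mono mult_left_mono le 1 2) auto
    ultimately show ?thesis by (rule le_less_trans[rotated])
  qed
  ultimately show thesis by (rule that)
qed

text \<open>
  Without source and without flux on the edges of \<open>K\<close> the continuity equation says that \<open>\<mu>\<close> has
  derivative zero a.e., and \<open>\<mu>\<close> is absolutely continuous. Reversibility makes the set of edges
  symmetric, so that both orientations of the flux vanish in the divergence.
\<close>

lemma CE_zero_energy:
  fixes K :: "'a::finite \<Rightarrow> 'a \<Rightarrow> real"
  assumes \<gamma>: "(\<mu>, V, h) \<in> CE K p \<mu>0 \<mu>1" and ab: "0 < a" "0 < b"
    and K: "\<And>x y. 0 \<le> K x y" and \<pi>: "\<And>x. 0 < \<pi> x" and rev: "reversible_kernel K \<pi>"
    and zero: "AE t in lebesgue_on {0..1}. energy_density a b K \<pi> \<mu> V h t = 0"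
  shows "\<mu>0 = \<mu>1"
proof
  fix x
  have sym: "0 < K v u" if "0 < K u v" for u v
  proof -
    have "K v u * \<pi> v = K u v * \<pi> u" using rev unfolding reversible_kernel_def by auto
    moreover have "0 < K u v * \<pi> u" using that \<pi> by simp
    ultimately have "0 < K v u * \<pi> v" by simp
    then show ?thesis by (rule zero_less_mult_pos2[OF _ \<pi>])
  qed
  have "AE t in lebesgue_on {0..1}. \<forall>x. \<exists>d. ((\<lambda>s. \<mu> s x) has_real_derivative d) (at t within {0..1}) \<and>
        d + divergence K (V t) x = h t * p x"
    using \<gamma> by (simp add: CE_def)
  with zero AE_space have "AE t in lebesgue_on {0..1}. ((\<lambda>s. \<mu> s x) has_real_derivative 0) (at t within {0..1})"
  proof eventually_elim
    case (elim t)
    have nn: "\<And>x. 0 \<le> \<mu> t x" using elim(2) \<gamma> by (auto simp: CE_def densities_def)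
    have "h t = 0" using elim(1) ab by (simp add: energy_density_def)
    moreover have "flux_action K \<pi> (\<mu> t) (V t) = 0" using elim(1) ab by (simp add: energy_density_def)
    then have "divergence K (V t) x = 0"
      unfolding flux_action_eq_0_iff[OF nn K \<pi>] using sym K by (intro divergence_eq_0) auto
    ultimately show ?case using elim(3) by (metis add.right_neutral mult_zero_left)
  qed
  then have "negligible {t\<in>{0..1}. \<not> ((\<lambda>s. \<mu> s x) has_real_derivative 0) (at t within {0..1})}"
    unfolding AE_lebesgue_on_iff_negligible .
  moreover have "absolutely_continuous_on {0..1} (\<lambda>s. \<mu> s x)" using \<gamma> by (simp add: CE_def)
  ultimately have "\<mu> 1 x = \<mu> 0 x"
    by (intro absolutely_continuous_on_zero_derivative[of 0 1 "\<lambda>s. \<mu> s x"]) auto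
  then show "\<mu>0 x = \<mu>1 x" using \<gamma> by (auto simp: CE_def)
qed

section \<open>Minimizers have constant speed\<close>

lemma energy_density_mult:
  assumes "c \<noteq> 0"
  shows "energy_density a b K \<pi> (\<lambda>t. \<mu> (\<tau> t)) (\<lambda>t x y. c * V (\<tau> t) x y) (\<lambda>t. c * h (\<tau> t)) t
    = ennreal (c\<^sup>2) * energy_density a b K \<pi> \<mu> V h (\<tau> t)"
proof -
  have "\<bar>c * h (\<tau> t)\<bar>\<^sup>2 = c\<^sup>2 * \<bar>h (\<tau> t)\<bar>\<^sup>2" by (simp add: power_mult_distrib)
  then have "ennreal (\<bar>c * h (\<tau> t)\<bar>\<^sup>2) = ennreal (c\<^sup>2) * ennreal (\<bar>h (\<tau> t)\<bar>\<^sup>2)"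
    by (simp only: ennreal_mult' zero_le_power2)
  then show ?thesis
    unfolding energy_density_def flux_action_mult[OF assms] by (simp add: distrib_left mult_ac)
qed

text \<open>
  The time change \<open>\<tau>\<close> maps \<open>{0..c'}\<close> onto \<open>{0..c}\<close> and \<open>{c'..1}\<close> onto \<open>{c..1}\<close>, affinely on each
  piece. Composing with \<open>\<tau>\<close> multiplies \<open>V\<close> and \<open>h\<close> by the slope and the energy density by
  its square; one power of the slope is absorbed by the substitution in the integral.
\<close>

lemma CE_piecewise_affine_reparametrization:
  assumes \<gamma>: "(\<mu>, V, h) \<in> CE K p \<mu>0 \<mu>1"
    and c: "0 < c" "c < 1" and c': "0 < c'" "c' < 1"
  obtains \<gamma>' where "\<gamma>' \<in> CE K p \<mu>0 \<mu>1"
    "quad_energy a b K' \<pi> \<gamma>' \<le>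
       ennreal (c / c') * (\<integral>\<^sup>+t. energy_density a b K' \<pi> \<mu> V h t * indicator {0..c} t \<partial>lebesgue) +
       ennreal ((1 - c) / (1 - c')) * (\<integral>\<^sup>+t. energy_density a b K' \<pi> \<mu> V h t * indicator {c..1} t \<partial>lebesgue)"
proof -
  define r where "r = c / c'"
  define r' where "r' = (1 - c) / (1 - c')"
  have r: "0 < r" "0 < r'" using c c' by (auto simp: r_def r'_def)
  have rc: "r * c' = c" "r' * (1 - c') = 1 - c" using c c' by (auto simp: r_def r'_def)
  \<comment> \<open>Each branch of \<open>\<tau>\<close> has the form \<open>q + s * t\<close> in which affine substitution is stated.\<close>
  define \<sigma> where "\<sigma> t = (if t \<le> c' then r else r')" for t
  define \<tau> where "\<tau> t = (if t \<le> c' then 0 + r * t else (1 - r') + r' * t)" for t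
  have \<sigma>: "\<sigma> t \<noteq> 0" for t using r by (simp add: \<sigma>_def)
  have key: "\<tau> t = c + \<sigma> t * (t - c')" for t
    using rc by (auto simp: \<tau>_def \<sigma>_def algebra_simps)
  have incr: "0 < \<tau> y - \<tau> x \<and> \<tau> y - \<tau> x \<le> max r r' * (y - x)" if "x < y" for x y
  proof -
    have "0 < r * (y - x)" "0 < r' * (y - x)" using r that by auto
    moreover have "r * (y - x) \<le> max r r' * (y - x)" "r' * (y - x) \<le> max r r' * (y - x)"
      using that by (auto intro!: mult_right_mono)
    moreover have "0 < r' * (y - c') + r * (c' - x) \<and> r' * (y - c') + r * (c' - x) \<le> max r r' * (y - x)"
      if xy: "x \<le> c'" "c' < y"
    proof -
      have "r' * (y - c') \<le> max r r' * (y - c')" "r * (c' - x) \<le> max r r' * (c' - x)"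
        using xy by (auto intro!: mult_right_mono)
      moreover have "0 < r' * (y - c')" "0 \<le> r * (c' - x)" using xy r by auto
      ultimately show ?thesis by (simp add: algebra_simps)
    qed
    moreover have "\<tau> y - \<tau> x = (if y \<le> c' then r * (y - x) else if c' < x then r' * (y - x)
        else r' * (y - c') + r * (c' - x))"
      using that unfolding key \<sigma>_def by (auto simp: algebra_simps)
    ultimately show ?thesis using that by (auto split: if_splits)
  qed
  have smono: "strict_mono_on {0..1} \<tau>" using incr by (force intro: strict_mono_onI)
  have lip: "(max r r')-lipschitz_on {0..1} \<tau>"
  proof (rule lipschitz_onI)
    fix x y show "dist (\<tau> x) (\<tau> y) \<le> max r r' * dist x y"
      using incr[of x y] incr[of y x] by (cases x y rule: linorder_cases) (auto simp: dist_real_def)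
  qed (use r in auto)
  have \<tau>01: "\<tau> 0 = 0" "\<tau> 1 = 1" using c' by (auto simp: \<tau>_def)
  have img: "\<tau> t \<in> {0..1}" if "t \<in> {0..1}" for t
    using incr[of 0 t] incr[of t 1] \<tau>01 that by (cases "t = 0"; cases "t = 1") auto
  define \<mu>' where "\<mu>' t = \<mu> (\<tau> t)" for t
  define V' where "V' t x y = \<sigma> t * V (\<tau> t) x y" for t x y
  define h' where "h' t = \<sigma> t * h (\<tau> t)" for t
  have meas: "(\<lambda>t. \<sigma> t * f (\<tau> t)) \<in> borel_measurable (lebesgue_on {0..1})"
    if f: "f \<in> borel_measurable (lebesgue_on {0..1})" for f :: "real \<Rightarrow> real"
  proof -
    define F where "F t = (if t \<in> {0..1} then f t else 0)" for t
    have F: "F \<in> borel_measurable lebesgue"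
      using f borel_measurable_if[of "{0..1}" f] unfolding F_def by simp
    have aff: "(\<lambda>t. F (u + s * t)) \<in> borel_measurable lebesgue" if "s \<noteq> 0" for s u :: real
      using measurable_compose[OF lebesgue_affine_measurable[where c = "\<lambda>_. s" and t = u] F] that by simp
    then have [measurable]: "(\<lambda>t. F (0 + r * t)) \<in> borel_measurable lebesgue"
      "(\<lambda>t. F ((1 - r') + r' * t)) \<in> borel_measurable lebesgue"
      using aff[of r 0] aff[of r' "1 - r'"] r by simp_all
    have [measurable]: "(\<lambda>t::real. t) \<in> borel_measurable lebesgue"
      by (rule measurable_completion) simp
    have "(\<lambda>t. if t \<le> c' then r * F (0 + r * t) else r' * F ((1 - r') + r' * t)) \<in> borel_measurable lebesgue"
      by measurable
    then have "(\<lambda>t. if t \<le> c' then r * F (0 + r * t) else r' * F ((1 - r') + r' * t)) \<in> borel_measurable (lebesgue_on {0..1})"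
      by (rule measurable_restrict_space1)
    moreover have "(if t \<le> c' then r * F (0 + r * t) else r' * F ((1 - r') + r' * t)) = \<sigma> t * f (\<tau> t)"
      if "t \<in> space (lebesgue_on {0..1})" for t
    proof -
      have "\<sigma> t * f (\<tau> t) = \<sigma> t * F (\<tau> t)" using img[of t] that by (simp add: F_def)
      then show ?thesis by (cases "t \<le> c'") (auto simp: \<tau>_def \<sigma>_def)
    qed
    ultimately show ?thesis by (rule measurable_cong[THEN iffD1, rotated])
  qed
  have CE': "(\<mu>', V', h') \<in> CE K p \<mu>0 \<mu>1"
    unfolding CE_def mem_Collect_eq prod.case
  proof (intro conjI allI ballI)
    fix t :: real assume "t \<in> {0..1}"
    then show "\<mu>' t \<in> densities" using \<gamma> img unfolding CE_def \<mu>'_def by blast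
  next
    fix x show "absolutely_continuous_on {0..1} (\<lambda>t. \<mu>' t x)"
      unfolding \<mu>'_def using \<gamma> img
      by (intro absolutely_continuous_on_compose[OF _ lip smono]) (auto simp: CE_def)
  next
    show "\<mu>' 0 = \<mu>0" "\<mu>' 1 = \<mu>1" using \<gamma> \<tau>01 by (auto simp: CE_def \<mu>'_def)
  next
    fix x y show "(\<lambda>t. V' t x y) \<in> borel_measurable (lebesgue_on {0..1})"
      unfolding V'_def using \<gamma> by (intro meas) (auto simp: CE_def)
  next
    show "h' \<in> borel_measurable (lebesgue_on {0..1})"
      unfolding h'_def[abs_def] using \<gamma> by (intro meas) (auto simp: CE_def)
  next
    let ?Q = "\<lambda>\<mu> V h t. \<forall>x. \<exists>d. ((\<lambda>s. \<mu> s x) has_real_derivative d) (at t within {0..1}) \<and>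
        d + divergence K (V t) x = h t * p x"
    define N where "N = {t\<in>{0..1}. \<not> ?Q \<mu> V h t}"
    have "negligible N"
      using \<gamma> unfolding CE_def N_def by (auto simp: AE_lebesgue_on_iff_negligible)
    \<comment> \<open>At the kink \<open>c'\<close> the time change need not be differentiable.\<close>
    then have "negligible ({t. 0 + r * t \<in> N} \<union> {t. (1 - r') + r' * t \<in> N} \<union> {c'})"
      using r by (intro negligible_Un negligible_affine_vimage) auto
    moreover have "{t\<in>{0..1}. \<not> ?Q \<mu>' V' h' t} \<subseteq> {t. 0 + r * t \<in> N} \<union> {t. (1 - r') + r' * t \<in> N} \<union> {c'}"
    proof (rule subsetI, rule ccontr)
      fix t assume t: "t \<in> {t\<in>{0..1}. \<not> ?Q \<mu>' V' h' t}"
        and "t \<notin> {t. 0 + r * t \<in> N} \<union> {t. (1 - r') + r' * t \<in> N} \<union> {c'}"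
      then have tN: "\<tau> t \<notin> N" and tc: "t \<noteq> c'" and t01: "t \<in> {0..1}" by (auto simp: \<tau>_def)
      have Q: "?Q \<mu> V h (\<tau> t)" using tN img[OF t01] unfolding N_def by blast
      have d\<tau>: "(\<tau> has_real_derivative \<sigma> t) (at t within {0..1})"
      proof (cases "t < c'")
        case True
        have "((\<lambda>t. 0 + r * t) has_real_derivative r) (at t)" by (auto intro!: derivative_eq_intros)
        then have "(\<tau> has_real_derivative r) (at t)"
          by (rule has_field_derivative_transform_within_open[where S = "{..<c'}"]) (use True in \<open>auto simp: \<tau>_def\<close>)
        then show ?thesis using True by (auto simp: \<sigma>_def intro: has_field_derivative_at_within)
      next
        case False
        have "((\<lambda>t. (1 - r') + r' * t) has_real_derivative r') (at t)" by (auto intro!: derivative_eq_intros)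
        then have "(\<tau> has_real_derivative r') (at t)"
          by (rule has_field_derivative_transform_within_open[where S = "{c'<..}"]) (use False tc in \<open>auto simp: \<tau>_def\<close>)
        then show ?thesis using False tc by (auto simp: \<sigma>_def intro: has_field_derivative_at_within)
      qed
      have "?Q \<mu>' V' h' t"
      proof
        fix x
        obtain d where d: "((\<lambda>s. \<mu> s x) has_real_derivative d) (at (\<tau> t) within {0..1})"
          "d + divergence K (V (\<tau> t)) x = h (\<tau> t) * p x" using Q by blast
        have "((\<lambda>s. \<mu> s x) has_real_derivative d) (at (\<tau> t) within \<tau> ` {0..1})"
          by (rule DERIV_subset[OF d(1)]) (use img in auto)
        from DERIV_image_chain[OF this d\<tau>]
        have "((\<lambda>s. \<mu>' s x) has_real_derivative d * \<sigma> t) (at t within {0..1})"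
          by (simp add: \<mu>'_def o_def)
        moreover have "divergence K (V' t) x = \<sigma> t * divergence K (V (\<tau> t)) x"
          by (simp only: V'_def[abs_def] divergence_mult)
        then have "d * \<sigma> t + divergence K (V' t) x = h' t * p x"
          using arg_cong[OF d(2), of "\<lambda>z. \<sigma> t * z"] by (simp add: h'_def algebra_simps)
        ultimately show "\<exists>d. ((\<lambda>s. \<mu>' s x) has_real_derivative d) (at t within {0..1}) \<and>
            d + divergence K (V' t) x = h' t * p x" by blast
      qed
      then show False using t by blast
    qed
    ultimately show "AE t in lebesgue_on {0..1}. ?Q \<mu>' V' h' t"
      unfolding AE_lebesgue_on_iff_negligible by (rule negligible_subset)
  qed
  define e where "e = energy_density a b K' \<pi> \<mu> V h"
  have e_meas: "(\<lambda>t. e t * indicator {u..v} t) \<in> borel_measurable lebesgue" if "0 \<le> u" "v \<le> 1" for u v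
  proof -
    have "(\<lambda>t. e t * indicator {0..1} t) \<in> borel_measurable lebesgue"
      using CE_borel_measurable_energy_density[OF \<gamma>] unfolding e_def
      by (subst borel_measurable_restrict_space_iff_ennreal[symmetric]) auto
    moreover have "(indicator {u..v} :: real \<Rightarrow> ennreal) \<in> borel_measurable lebesgue"
      by (intro borel_measurable_indicator) simp
    ultimately have "(\<lambda>t. e t * indicator {0..1} t * indicator {u..v} t) \<in> borel_measurable lebesgue"
      by (rule borel_measurable_times_ennreal)
    moreover have "e t * indicator {0..1} t * indicator {u..v} t = e t * indicator {u..v} t" for t
      using that by (auto simp: indicator_def)
    ultimately show ?thesis by simp
  qed
  have piece: "(\<integral>\<^sup>+t. ennreal (s\<^sup>2) * (e (q + s * t) * indicator {u..v} (q + s * t)) \<partial>lebesgue)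
      = ennreal s * (\<integral>\<^sup>+t. e t * indicator {u..v} t \<partial>lebesgue)"
    if "0 < s" "0 \<le> u" "v \<le> 1" for s q u v
  proof -
    have m: "(\<lambda>t. e (q + s * t) * indicator {u..v} (q + s * t)) \<in> borel_measurable lebesgue"
      using measurable_compose[OF lebesgue_affine_measurable[where c = "\<lambda>_. s" and t = q] e_meas[of u v]] that by simp
    have "ennreal (s\<^sup>2) = ennreal s * ennreal s" using that by (simp add: power2_eq_square ennreal_mult)
    then show ?thesis
      using nn_integral_real_affine_lebesgue[OF e_meas[of u v], of s q] that m
      by (simp add: nn_integral_cmult mult.assoc)
  qed
  have e': "energy_density a b K' \<pi> \<mu>' V' h' t = ennreal ((\<sigma> t)\<^sup>2) * e (\<tau> t)" for t
    using energy_density_mult[OF \<sigma>, of a b K' \<pi> \<mu> \<tau> t V h t]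
    by (simp add: e_def energy_density_def \<mu>'_def V'_def[abs_def] h'_def)
  have "quad_energy a b K' \<pi> (\<mu>', V', h') =
      (\<integral>\<^sup>+t. ennreal ((\<sigma> t)\<^sup>2) * e (\<tau> t) * indicator {0..1} t \<partial>lebesgue)"
    unfolding quad_energy_eq[OF CE'] e' by (simp add: nn_integral_restrict_space)
  also have "\<dots> \<le> (\<integral>\<^sup>+t. ennreal (r\<^sup>2) * (e (0 + r * t) * indicator {0..c} (0 + r * t)) +
      ennreal (r'\<^sup>2) * (e ((1 - r') + r' * t) * indicator {c..1} ((1 - r') + r' * t)) \<partial>lebesgue)"
  proof (rule nn_integral_mono)
    fix t :: real
    show "ennreal ((\<sigma> t)\<^sup>2) * e (\<tau> t) * indicator {0..1} t \<le>
      ennreal (r\<^sup>2) * (e (0 + r * t) * indicator {0..c} (0 + r * t)) +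
      ennreal (r'\<^sup>2) * (e ((1 - r') + r' * t) * indicator {c..1} ((1 - r') + r' * t))"
    proof (cases "t \<in> {0..1}")
      case True
      show ?thesis
      proof (cases "t \<le> c'")
        case le: True
        have "r * t \<le> r * c'" using le r by simp
        then have "0 + r * t \<in> {0..c}" using True r rc by simp
        then show ?thesis using le True by (simp add: \<sigma>_def \<tau>_def)
      next
        case False
        have "0 \<le> r' * (t - c')" "0 \<le> r' * (1 - t)" using False True r by auto
        then have "(1 - r') + r' * t \<in> {c..1}" using rc by (simp add: algebra_simps)
        then show ?thesis using False True by (simp add: \<sigma>_def \<tau>_def)
      qed
    qed simp
  qed
  also have "\<dots> = ennreal r * (\<integral>\<^sup>+t. e t * indicator {0..c} t \<partial>lebesgue) +
      ennreal r' * (\<integral>\<^sup>+t. e t * indicator {c..1} t \<partial>lebesgue)"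
  proof -
    have "(\<lambda>t. ennreal (s\<^sup>2) * (e (q + s * t) * indicator {u..v} (q + s * t))) \<in> borel_measurable lebesgue"
      if "0 < s" "0 \<le> u" "v \<le> 1" for s q u v
      using measurable_compose[OF lebesgue_affine_measurable[where c = "\<lambda>_. s" and t = q] e_meas[of u v]] that by simp
    note nn_integral_add[OF this[where s = r and u = 0 and v = c and q = 0]
        this[where s = r' and u = c and v = 1 and q = "1 - r'"]]
    then show ?thesis
      using piece[where s = r and u = 0 and v = c and q = 0]
        piece[where s = r' and u = c and v = 1 and q = "1 - r'"] c r by (simp only: less_imp_le order_refl simp_thms)
  qed
  finally show thesis using that[OF CE'] unfolding e_def r_def r'_def by blast
qed

text \<open>
  Let \<open>F c\<close> be the energy spent up to time \<open>c\<close>. Comparison with the time change that reaches the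
  state at time \<open>c\<close> already at time \<open>c'\<close> gives
  \<open>E \<le> c / c' * F c + (1 - c) / (1 - c') * (E - F c)\<close> for all \<open>c'\<close>, which multiplies out to
  \<open>0 \<le> (c' - c) * (E * c' - F c)\<close>. Letting \<open>c'\<close> tend to \<open>c\<close> from either side yields
  \<open>F c = c * E\<close>, and differentiating this in \<open>c\<close> gives the claim.
\<close>

lemma minimizer_constant_speed:
  assumes min: "is_arg_min (quad_energy a b K' \<pi>) (\<lambda>\<gamma>. \<gamma> \<in> CE K p \<mu>0 \<mu>1) (\<mu>, V, h)"
    and fin: "quad_energy a b K' \<pi> (\<mu>, V, h) < \<infinity>"
  shows "AE t in lebesgue_on {0..1}. energy_density a b K' \<pi> \<mu> V h t = quad_energy a b K' \<pi> (\<mu>, V, h)"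
proof -
  have \<gamma>: "(\<mu>, V, h) \<in> CE K p \<mu>0 \<mu>1" using min by (simp add: is_arg_min_def)
  have opt: "quad_energy a b K' \<pi> (\<mu>, V, h) \<le> quad_energy a b K' \<pi> \<gamma>'" if "\<gamma>' \<in> CE K p \<mu>0 \<mu>1" for \<gamma>'
    using min that unfolding is_arg_min_def by (meson not_le)
  define e where "e = energy_density a b K' \<pi> \<mu> V h"
  have e[measurable]: "e \<in> borel_measurable (lebesgue_on {0..1})"
    unfolding e_def by (rule CE_borel_measurable_energy_density[OF \<gamma>])
  define f where "f t = enn2real (e t)" for t
  have f0: "0 \<le> f t" for t by (simp add: f_def)
  define E where "E = enn2real (quad_energy a b K' \<pi> (\<mu>, V, h))"
  have Ee: "quad_energy a b K' \<pi> (\<mu>, V, h) = ennreal E" using fin by (simp add: E_def)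
  have E0: "0 \<le> E" by (simp add: E_def)
  have int_e: "(\<integral>\<^sup>+t. e t \<partial>lebesgue_on {0..1}) = ennreal E"
    using Ee quad_energy_eq[OF \<gamma>] by (simp add: e_def)
  have "AE t in lebesgue_on {0..1}. e t \<noteq> \<infinity>"
    using e int_e by (intro nn_integral_noteq_infinite) auto
  then have ef: "AE t in lebesgue_on {0..1}. e t = ennreal (f t)"
    by eventually_elim (simp add: f_def top.not_eq_extremum)
  have ef_ind: "(\<integral>\<^sup>+t. e t * indicator {u..v} t \<partial>lebesgue) = (\<integral>\<^sup>+t. ennreal (f t) * indicator {u..v} t \<partial>lebesgue)"
    if "0 \<le> u" "v \<le> 1" for u v
  proof (rule nn_integral_cong_AE)
    have "AE t in lebesgue. t \<in> {0..1} \<longrightarrow> e t = ennreal (f t)"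
      using ef by (simp add: AE_restrict_space_iff)
    then show "AE t in lebesgue. e t * indicator {u..v} t = ennreal (f t) * indicator {u..v} t"
      by eventually_elim (use that in \<open>auto simp: indicator_def\<close>)
  qed
  have fint: "(f has_integral E) {0..1}"
  proof -
    have "(\<lambda>t. f t * indicator {0..1} t) \<in> borel_measurable lebesgue"
    proof -
      have "f \<in> borel_measurable (lebesgue_on {0..1})"
        unfolding f_def[abs_def] by measurable
      then show ?thesis
        by (subst (asm) borel_measurable_restrict_space_iff) (simp_all add: mult.commute)
    qed
    moreover have "(\<integral>\<^sup>+t. ennreal (f t * indicator {0..1} t) \<partial>lebesgue) = ennreal E"
    proof -
      have "(\<integral>\<^sup>+t. ennreal (f t * indicator {0..1} t) \<partial>lebesgue) = (\<integral>\<^sup>+t. ennreal (f t) * indicator {0..1} t \<partial>lebesgue)"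
        by (intro nn_integral_cong) (auto simp: indicator_def)
      also have "\<dots> = (\<integral>\<^sup>+t. e t \<partial>lebesgue_on {0..1})"
        by (simp add: ef_ind[symmetric] nn_integral_restrict_space)
      finally show ?thesis using int_e by simp
    qed
    ultimately have "((\<lambda>t. f t * indicator {0..1} t) has_integral E) UNIV"
      using E0 by (subst has_integral_iff_nn_integral_lebesgue) (auto simp: f_def)
    moreover have "(\<lambda>t. f t * indicator {0..1} t) = (\<lambda>t. if t \<in> {0..1} then f t else 0)"
      by (auto simp: indicator_def)
    ultimately show ?thesis by (simp add: has_integral_restrict_UNIV del: atLeastAtMost_iff)
  qed
  define F where "F t = integral {0..t} f" for t
  have Fe: "(\<integral>\<^sup>+t. e t * indicator {u..v} t \<partial>lebesgue) = ennreal (integral {u..v} f)"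
    if "0 \<le> u" "u \<le> v" "v \<le> 1" for u v
  proof -
    have "f integrable_on {u..v}"
      using fint that integrable_on_subinterval[of f "{0..1}" u v] by (auto simp: has_integral_integrable)
    then have "integral\<^sup>N lborel (\<lambda>t. ennreal (f t) * indicator {u..v} t) = ennreal (integral {u..v} f)"
      by (intro nn_integral_has_integral_lebesgue' integrable_integral) (simp_all add: f0)
    then have "(\<integral>\<^sup>+t. ennreal (f t) * indicator {u..v} t \<partial>lebesgue) = ennreal (integral {u..v} f)"
      by (simp only: nn_integral_completion)
    then show ?thesis by (rule trans[OF ef_ind[OF that(1,3)]])
  qed
  have F: "F c = c * E" if c: "0 < c" "c < 1" for c
  proof -
    have comb: "integral {0..c} f + integral {c..1} f = E"
      using fint c by (subst Henstock_Kurzweil_Integration.integral_combine) (auto simp: integral_unique has_integral_integrable)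
    have F0: "0 \<le> F c" unfolding F_def
      by (rule integral_nonneg) (use fint c integrable_on_subinterval[of f "{0..1}" 0 c] in \<open>auto simp: f0 has_integral_integrable\<close>)
    have F1: "0 \<le> E - F c"
    proof -
      have "0 \<le> integral {c..1} f"
        by (rule integral_nonneg) (use fint c integrable_on_subinterval[of f "{0..1}" c 1] in \<open>auto simp: f0 has_integral_integrable\<close>)
      then show ?thesis using comb by (simp add: F_def)
    qed
    have int0: "(\<integral>\<^sup>+t. e t * indicator {0..c} t \<partial>lebesgue) = ennreal (F c)"
      using Fe[of 0 c] c unfolding F_def by simp
    have "integral {c..1} f = E - F c" using comb by (simp add: F_def)
    then have int1: "(\<integral>\<^sup>+t. e t * indicator {c..1} t \<partial>lebesgue) = ennreal (E - F c)"
      using Fe[of c 1] c by simp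
    have ineq: "E \<le> c / c' * F c + (1 - c) / (1 - c') * (E - F c)" if c': "0 < c'" "c' < 1" for c'
    proof -
      obtain \<gamma>' where \<gamma>': "\<gamma>' \<in> CE K p \<mu>0 \<mu>1" "quad_energy a b K' \<pi> \<gamma>' \<le>
         ennreal (c / c') * (\<integral>\<^sup>+t. e t * indicator {0..c} t \<partial>lebesgue) +
         ennreal ((1 - c) / (1 - c')) * (\<integral>\<^sup>+t. e t * indicator {c..1} t \<partial>lebesgue)"
        by (rule CE_piecewise_affine_reparametrization[OF \<gamma> c c',
              where a = a and b = b and K' = K' and \<pi> = \<pi>, folded e_def])
      have n: "0 \<le> c / c'" "0 \<le> (1 - c) / (1 - c')" using c c' by auto
      have "ennreal E \<le> ennreal (c / c') * ennreal (F c) + ennreal ((1 - c) / (1 - c')) * ennreal (E - F c)"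
        using order_trans[OF opt[OF \<gamma>'(1)] \<gamma>'(2)] unfolding Ee int0 int1 .
      also have "\<dots> = ennreal (c / c' * F c + (1 - c) / (1 - c') * (E - F c))"
        by (simp only: ennreal_mult[OF n(1) F0] ennreal_mult[OF n(2) F1]
              ennreal_plus[OF mult_nonneg_nonneg[OF n(1) F0] mult_nonneg_nonneg[OF n(2) F1]])
      finally show ?thesis using c c' F0 F1 by (subst (asm) ennreal_le_iff) auto
    qed
    have core: "0 \<le> (c' - c) * (E * c' - F c)" if c': "0 < c'" "c' < 1" for c'
    proof -
      have "0 \<le> (c / c' * F c + (1 - c) / (1 - c') * (E - F c) - E) * (c' * (1 - c'))"
        using ineq[OF c'] c' by (intro mult_nonneg_nonneg) auto
      also have "\<dots> = (c' - c) * (E * c' - F c)"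
        using c' by (simp add: field_simps)
      finally show ?thesis .
    qed
    have "F c \<le> E * c' " if "c < c'" "c' < 1" for c'
      using core[of c'] that c by (simp add: zero_le_mult_iff)
    then have "F c \<le> E * c"
    proof -
      have "((\<lambda>c'. E * c') \<longlongrightarrow> E * c) (at_right c)" by (intro tendsto_intros)
      moreover have "\<forall>\<^sub>F c' in at_right c. F c \<le> E * c'"
        using \<open>\<And>c'. c < c' \<Longrightarrow> c' < 1 \<Longrightarrow> F c \<le> E * c'\<close> c by (auto simp: eventually_at_right[of c 1])
      ultimately show ?thesis by (rule tendsto_lowerbound) simp
    qed
    moreover have "E * c' \<le> F c" if "0 < c'" "c' < c" for c'
      using core[of c'] that c by (simp add: zero_le_mult_iff)
    then have "E * c \<le> F c"
    proof -
      have "((\<lambda>c'. E * c') \<longlongrightarrow> E * c) (at_left c)" by (intro tendsto_intros)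
      moreover have "\<forall>\<^sub>F c' in at_left c. E * c' \<le> F c"
        using \<open>\<And>c'. 0 < c' \<Longrightarrow> c' < c \<Longrightarrow> E * c' \<le> F c\<close> c by (auto simp: eventually_at_left[of 0 c])
      ultimately show ?thesis by (rule tendsto_upperbound) simp
    qed
    ultimately show ?thesis by (simp add: mult.commute)
  qed
  obtain N where N: "negligible N"
    "\<And>t. t \<in> {0..1} - N \<Longrightarrow> (F has_real_derivative f t) (at t within {0..1})"
    using has_real_derivative_indefinite_integral_AE[of f 0 1] fint unfolding F_def[abs_def]
    by (metis has_integral_integrable)
  have fE: "f t = E" if t: "t \<in> {0<..<1} - N" for t
  proof -
    have "(F has_real_derivative f t) (at t)"
      using N(2)[of t] t at_within_interior[of t "{0..1::real}"] by simp
    moreover have "(F has_real_derivative E) (at t)"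
    proof (rule has_field_derivative_transform_within_open[where S = "{0<..<1}"])
      show "((\<lambda>t. t * E) has_real_derivative E) (at t)" by (auto intro!: derivative_eq_intros)
    qed (use t F in auto)
    ultimately show ?thesis by (rule DERIV_unique)
  qed
  have "{t\<in>{0..1}. \<not> f t = E} \<subseteq> N \<union> {0, 1}"
  proof (rule subsetI)
    fix t assume t: "t \<in> {t\<in>{0..1}. \<not> f t = E}"
    then have "t \<notin> {0<..<1} - N" using fE[of t] by blast
    then show "t \<in> N \<union> {0, 1}" using t by auto
  qed
  moreover have "negligible (N \<union> {0, 1})" using N(1) by (simp add: negligible_Un)
  ultimately have "AE t in lebesgue_on {0..1}. f t = E"
    unfolding AE_lebesgue_on_iff_negligible by (rule negligible_subset[rotated])
  with ef show ?thesis by eventually_elim (simp add: Ee e_def)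
qed

section \<open>Adding mass to a trajectory\<close>

lemma CE_add_mass:
  fixes K :: "'a::finite \<Rightarrow> 'a \<Rightarrow> real"
  assumes \<gamma>: "(\<mu>, V, h) \<in> CE K p \<mu>0 \<mu>1"
    and p: "\<And>x. 0 \<le> p x"
    and \<phi>: "L-lipschitz_on {0..1} \<phi>" "\<And>t. t \<in> {0..1} \<Longrightarrow> 0 \<le> \<phi> t" "\<phi> 0 = 0" "\<phi> 1 = 0"
    and \<psi>: "\<psi> \<in> borel_measurable (lebesgue_on {0..1})"
    and d\<phi>: "AE t in lebesgue_on {0..1}. (\<phi> has_real_derivative \<psi> t) (at t within {0..1})"
    and \<epsilon>: "0 \<le> \<epsilon>"
  shows "(\<lambda>t x. \<mu> t x + \<epsilon> * \<phi> t * p x, V, \<lambda>t. h t + \<epsilon> * \<psi> t) \<in> CE K p \<mu>0 \<mu>1"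
  unfolding CE_def mem_Collect_eq prod.case
proof (intro conjI allI ballI)
  fix t :: real assume "t \<in> {0..1}"
  then show "(\<lambda>x. \<mu> t x + \<epsilon> * \<phi> t * p x) \<in> densities"
    using \<gamma> \<epsilon> \<phi>(2) p by (auto simp: CE_def densities_def intro!: add_nonneg_nonneg mult_nonneg_nonneg)
next
  fix x
  have "(\<bar>\<epsilon> * p x\<bar> * L)-lipschitz_on {0..1} (\<lambda>t. (\<epsilon> * p x) * \<phi> t)"
    by (rule lipschitz_on_cmult_real[OF \<phi>(1)])
  then have "absolutely_continuous_on {0..1} (\<lambda>t. \<epsilon> * \<phi> t * p x)"
    by (intro absolutely_continuous_onI_lipschitz) (simp add: mult_ac)
  then show "absolutely_continuous_on {0..1} (\<lambda>t. \<mu> t x + \<epsilon> * \<phi> t * p x)"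
    using \<gamma> by (intro absolutely_continuous_on_add) (auto simp: CE_def)
next
  show "(\<lambda>x. \<mu> 0 x + \<epsilon> * \<phi> 0 * p x) = \<mu>0" "(\<lambda>x. \<mu> 1 x + \<epsilon> * \<phi> 1 * p x) = \<mu>1"
    using \<gamma> \<phi> by (auto simp: CE_def)
next
  fix x y show "(\<lambda>t. V t x y) \<in> borel_measurable (lebesgue_on {0..1})"
    using \<gamma> by (simp add: CE_def)
next
  have [measurable]: "h \<in> borel_measurable (lebesgue_on {0..1})" using \<gamma> by (simp add: CE_def)
  note \<psi>[measurable]
  show "(\<lambda>t. h t + \<epsilon> * \<psi> t) \<in> borel_measurable (lebesgue_on {0..1})" by measurable
next
  have "AE t in lebesgue_on {0..1}. \<forall>x. \<exists>d. ((\<lambda>s. \<mu> s x) has_real_derivative d) (at t within {0..1}) \<and>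
        d + divergence K (V t) x = h t * p x"
    using \<gamma> by (simp add: CE_def)
  with d\<phi> show "AE t in lebesgue_on {0..1}. \<forall>x. \<exists>d.
      ((\<lambda>s. \<mu> s x + \<epsilon> * \<phi> s * p x) has_real_derivative d) (at t within {0..1}) \<and>
      d + divergence K (V t) x = (h t + \<epsilon> * \<psi> t) * p x"
  proof eventually_elim
    case (elim t)
    show ?case
    proof
      fix x
      obtain d where d: "((\<lambda>s. \<mu> s x) has_real_derivative d) (at t within {0..1})"
        "d + divergence K (V t) x = h t * p x" using elim(2) by blast
      have "((\<lambda>s. \<mu> s x + \<epsilon> * \<phi> s * p x) has_real_derivative d + \<epsilon> * \<psi> t * p x) (at t within {0..1})"
        using d(1) elim(1) by (auto intro!: derivative_eq_intros)
      moreover have "d + \<epsilon> * \<psi> t * p x + divergence K (V t) x = (h t + \<epsilon> * \<psi> t) * p x"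
        using d(2) by (simp add: algebra_simps)
      ultimately show "\<exists>d. ((\<lambda>s. \<mu> s x + \<epsilon> * \<phi> s * p x) has_real_derivative d) (at t within {0..1}) \<and>
        d + divergence K (V t) x = (h t + \<epsilon> * \<psi> t) * p x" by blast
    qed
  qed
qed

text \<open>
  Let \<open>B \<epsilon> t\<close> be the flux action after the mass \<open>\<epsilon> * \<phi> t * p\<close> has been added, and \<open>\<kappa>\<close> so small that
  \<open>\<kappa> * \<mu> \<le> p\<close> along the trajectory. Then \<open>(1 + \<epsilon> * \<kappa> * \<phi> t) * B \<epsilon> t \<le> B 0 t\<close>, so the
  saving in flux action is at least \<open>\<epsilon> * \<kappa>\<close> times the integral of \<open>\<phi> * B \<epsilon>\<close>, which is at least
  that of \<open>\<phi> * B 1\<close>. The source costs at most \<open>a\<^sup>2 * \<epsilon>\<^sup>2\<close> more, by \<open>orth\<close>. As \<open>\<epsilon>\<close> tends to 0, the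
  integral \<open>J\<close> of \<open>\<phi> * B 1\<close> must vanish, and \<open>B 1 t\<close> and \<open>B 0 t\<close> have the same zeros.
\<close>

lemma minimizer_no_flux_where_mass_can_be_added:
  fixes K :: "'a::finite \<Rightarrow> 'a \<Rightarrow> real"
  assumes min: "is_arg_min (quad_energy a b K \<pi>) (\<lambda>\<gamma>. \<gamma> \<in> CE K p \<mu>0 \<mu>1) (\<mu>, V, h)"
    and fin: "quad_energy a b K \<pi> (\<mu>, V, h) < \<infinity>"
    and ab: "0 < a" "0 < b"
    and K: "\<And>x y. 0 \<le> K x y" and \<pi>: "\<And>x. 0 < \<pi> x" and p: "\<And>x. 0 < p x"
    and \<phi>: "L-lipschitz_on {0..1} \<phi>" "\<And>t. t \<in> {0..1} \<Longrightarrow> 0 \<le> \<phi> t" "\<phi> 0 = 0" "\<phi> 1 = 0"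
    and \<psi>: "\<psi> \<in> borel_measurable (lebesgue_on {0..1})" "\<And>t. t \<in> {0..1} \<Longrightarrow> \<bar>\<psi> t\<bar> \<le> 1"
    and d\<phi>: "AE t in lebesgue_on {0..1}. (\<phi> has_real_derivative \<psi> t) (at t within {0..1})"
    and orth: "\<And>t. t \<in> {0..1} \<Longrightarrow> h t * \<psi> t = 0"
  shows "AE t in lebesgue_on {0..1}. \<phi> t = 0 \<or> flux_action K \<pi> (\<mu> t) (V t) = 0"
proof -
  let ?M = "lebesgue_on {0..1::real}"
  have \<gamma>: "(\<mu>, V, h) \<in> CE K p \<mu>0 \<mu>1" using min by (simp add: is_arg_min_def)
  have opt: "quad_energy a b K \<pi> (\<mu>, V, h) \<le> quad_energy a b K \<pi> \<gamma>'" if "\<gamma>' \<in> CE K p \<mu>0 \<mu>1" for \<gamma>'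
    using min that unfolding is_arg_min_def by (meson not_le)
  have \<mu>: "0 \<le> \<mu> t x" if "t \<in> {0..1}" for t x using \<gamma> that by (auto simp: CE_def densities_def)
  \<comment> \<open>A bound for the densities along the whole trajectory, by compactness.\<close>
  obtain C where C: "\<And>t x. t \<in> {0..1} \<Longrightarrow> \<mu> t x \<le> C" "0 < C"
  proof -
    have "\<exists>C. \<forall>t\<in>{0..1}. \<mu> t x \<le> C" for x
    proof -
      have "continuous_on {0..1} (\<lambda>t. \<mu> t x)"
        using \<gamma> by (intro absolutely_continuous_on_imp_continuous_on) (simp add: CE_def)
      then have "bounded ((\<lambda>t. \<mu> t x) ` {0..1})"
        by (intro compact_imp_bounded compact_continuous_image) auto
      then show ?thesis unfolding bounded_iff by (metis abs_le_D1 image_eqI real_norm_def)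
    qed
    then obtain c where c: "\<And>t x. t \<in> {0..1} \<Longrightarrow> \<mu> t x \<le> c x" by metis
    have "\<mu> t x \<le> max 1 (Max (range c))" if "t \<in> {0..1}" for t x
      using c[OF that, of x] Max_ge[of "range c" "c x"] by (simp add: le_max_iff_disj order_trans)
    then show thesis using that[of "max 1 (Max (range c))"] by simp
  qed
  define q where "q = Min (range p)"
  have q: "0 < q" "\<And>x. q \<le> p x" using p by (auto simp: q_def)
  define \<kappa> where "\<kappa> = q / C"
  have \<kappa>: "0 < \<kappa>" using q C by (simp add: \<kappa>_def)
  have \<kappa>\<mu>: "\<kappa> * \<mu> t x \<le> p x" if "t \<in> {0..1}" for t x
  proof -
    have "\<kappa> * \<mu> t x \<le> \<kappa> * C" using C(1)[OF that] \<kappa> by (intro mult_left_mono) auto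
    also have "\<dots> = q" using C by (simp add: \<kappa>_def)
    finally show ?thesis using q(2)[of x] by simp
  qed
  define \<nu> where "\<nu> \<epsilon> t x = \<mu> t x + \<epsilon> * \<phi> t * p x" for \<epsilon> t x
  define B where "B \<epsilon> t = flux_action K \<pi> (\<nu> \<epsilon> t) (V t)" for \<epsilon> t
  have CE: "(\<nu> \<epsilon>, V, \<lambda>t. h t + \<epsilon> * \<psi> t) \<in> CE K p \<mu>0 \<mu>1" if "0 \<le> \<epsilon>" for \<epsilon>
    unfolding \<nu>_def[abs_def] using p by (intro CE_add_mass[OF \<gamma> _ \<phi> \<psi>(1) d\<phi> that]) (simp add: less_imp_le)
  have B_meas[measurable]: "B \<epsilon> \<in> borel_measurable ?M" if "0 \<le> \<epsilon>" for \<epsilon>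
    unfolding B_def[abs_def] by (rule CE_borel_measurable(4)[OF CE[OF that]])
  have "continuous_on {0..1} \<phi>" using \<phi>(1) by (rule lipschitz_on_continuous_on)
  then have [measurable]: "\<phi> \<in> borel_measurable ?M"
    by (intro continuous_imp_measurable_on_sets_lebesgue) auto
  have [measurable]: "h \<in> borel_measurable ?M" using \<gamma> by (simp add: CE_def)
  have B0: "B 0 t = flux_action K \<pi> (\<mu> t) (V t)" for t by (simp add: B_def \<nu>_def[abs_def])
  have decay: "ennreal (1 + \<epsilon> * \<kappa> * \<phi> t) * B \<epsilon> t \<le> B 0 t" if "0 \<le> \<epsilon>" "t \<in> {0..1}" for \<epsilon> t
    unfolding B0 unfolding B_def
  proof (rule flux_action_scale)
    show "1 \<le> 1 + \<epsilon> * \<kappa> * \<phi> t" using that \<kappa> \<phi>(2)[OF that(2)] by simp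
    show "0 \<le> \<mu> t x" for x using \<mu> that by simp
    have "\<epsilon> * \<phi> t * (\<kappa> * \<mu> t x) \<le> \<epsilon> * \<phi> t * p x" for x
      using \<kappa>\<mu>[OF that(2), of x] \<phi>(2)[OF that(2)] that by (intro mult_left_mono mult_nonneg_nonneg) auto
    then show "(1 + \<epsilon> * \<kappa> * \<phi> t) * \<mu> t x \<le> \<nu> \<epsilon> t x" for x
      unfolding \<nu>_def by (simp add: algebra_simps)
  qed
  have mono: "B 1 t \<le> B \<epsilon> t" if "0 \<le> \<epsilon>" "\<epsilon> \<le> 1" "t \<in> {0..1}" for \<epsilon> t
  proof -
    have "0 \<le> \<phi> t * p x" for x using \<phi>(2)[OF that(3)] p by (simp add: less_imp_le)
    then have "ennreal 1 * B 1 t \<le> B \<epsilon> t" unfolding B_def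
      using that \<mu>[OF that(3)] mult_right_mono[OF that(2)]
      by (intro flux_action_scale) (auto simp: \<nu>_def mult.assoc)
    then show ?thesis by simp
  qed
  define H where "H = (\<integral>\<^sup>+t. ennreal (\<bar>h t\<bar>\<^sup>2) \<partial>?M)"
  define I where "I \<epsilon> = (\<integral>\<^sup>+t. B \<epsilon> t \<partial>?M)" for \<epsilon>
  define J where "J = (\<integral>\<^sup>+t. ennreal (\<phi> t) * B 1 t \<partial>?M)"
  have QE: "quad_energy a b K \<pi> (\<mu>, V, h) = ennreal (a\<^sup>2) * H + ennreal (b\<^sup>2) * I 0"
    unfolding quad_energy_def prod.case H_def I_def B0 ..
  have finH: "H < \<infinity>" "I 0 < \<infinity>" using fin ab unfolding QE by (auto simp: ennreal_mult_less_top)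
  have ineq1: "ennreal (a\<^sup>2) * H + ennreal (b\<^sup>2) * I 0 \<le> ennreal (a\<^sup>2) * (H + ennreal (\<epsilon>\<^sup>2)) + ennreal (b\<^sup>2) * I \<epsilon>"
    if "0 \<le> \<epsilon>" for \<epsilon>
  proof -
    have "ennreal (\<bar>h t + \<epsilon> * \<psi> t\<bar>\<^sup>2) \<le> ennreal (\<bar>h t\<bar>\<^sup>2) + ennreal (\<epsilon>\<^sup>2)" if t: "t \<in> {0..1}" for t
    proof -
      have "(h t + \<epsilon> * \<psi> t)\<^sup>2 = (h t)\<^sup>2 + \<epsilon>\<^sup>2 * (\<psi> t)\<^sup>2"
        using orth[OF t] by (simp add: power2_sum power_mult_distrib) (metis mult.left_commute mult_zero_right)
      also have "\<dots> \<le> (h t)\<^sup>2 + \<epsilon>\<^sup>2 * 1"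
        using \<psi>(2)[OF t] by (intro add_left_mono mult_left_mono) (auto simp: abs_square_le_1)
      finally show ?thesis by (simp flip: ennreal_plus)
    qed
    then have "(\<integral>\<^sup>+t. ennreal (\<bar>h t + \<epsilon> * \<psi> t\<bar>\<^sup>2) \<partial>?M) \<le> (\<integral>\<^sup>+t. ennreal (\<bar>h t\<bar>\<^sup>2) + ennreal (\<epsilon>\<^sup>2) \<partial>?M)"
      by (intro nn_integral_mono) auto
    also have "\<dots> = H + ennreal (\<epsilon>\<^sup>2)"
      by (simp add: nn_integral_add H_def emeasure_restrict_space)
    finally have "quad_energy a b K \<pi> (\<nu> \<epsilon>, V, \<lambda>t. h t + \<epsilon> * \<psi> t) \<le> ennreal (a\<^sup>2) * (H + ennreal (\<epsilon>\<^sup>2)) + ennreal (b\<^sup>2) * I \<epsilon>"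
      unfolding quad_energy_def prod.case I_def B_def by (intro add_right_mono mult_left_mono) auto
    with opt[OF CE[OF that]] show ?thesis unfolding QE by (rule order_trans)
  qed
  have ineq2: "I \<epsilon> + ennreal (\<epsilon> * \<kappa>) * J \<le> I 0" if \<epsilon>: "0 \<le> \<epsilon>" "\<epsilon> \<le> 1" for \<epsilon>
  proof -
    note [measurable] = B_meas[OF \<epsilon>(1)] B_meas[of 1, simplified]
    have "I \<epsilon> + ennreal (\<epsilon> * \<kappa>) * J = (\<integral>\<^sup>+t. B \<epsilon> t + ennreal (\<epsilon> * \<kappa>) * (ennreal (\<phi> t) * B 1 t) \<partial>?M)"
      unfolding I_def J_def by (simp add: nn_integral_add nn_integral_cmult)
    also have "\<dots> \<le> (\<integral>\<^sup>+t. B 0 t \<partial>?M)"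
    proof (rule nn_integral_mono)
      fix t assume "t \<in> space ?M"
      then have t: "t \<in> {0..1}" by simp
      have nn: "0 \<le> \<epsilon> * \<kappa>" "0 \<le> \<phi> t" using \<epsilon> \<kappa> \<phi>(2)[OF t] by auto
      have "B \<epsilon> t + ennreal (\<epsilon> * \<kappa>) * (ennreal (\<phi> t) * B 1 t) \<le> B \<epsilon> t + ennreal (\<epsilon> * \<kappa>) * (ennreal (\<phi> t) * B \<epsilon> t)"
        using mono[OF \<epsilon> t] by (intro add_left_mono mult_left_mono) auto
      also have "\<dots> = ennreal (1 + \<epsilon> * \<kappa> * \<phi> t) * B \<epsilon> t"
        unfolding ennreal_plus[OF zero_le_one mult_nonneg_nonneg[OF nn]] ennreal_mult[OF nn] ennreal_1
        by (simp only: distrib_right mult.assoc mult_1_left)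
      also have "\<dots> \<le> B 0 t" using decay[OF \<epsilon>(1) t] .
      finally show "B \<epsilon> t + ennreal (\<epsilon> * \<kappa>) * (ennreal (\<phi> t) * B 1 t) \<le> B 0 t" .
    qed
    finally show ?thesis unfolding I_def .
  qed
  have "J < \<infinity>"
  proof -
    have "ennreal \<kappa> * J \<le> I 0" using order_trans[OF _ ineq2[of 1], of "ennreal \<kappa> * J"] by simp
    then have "ennreal \<kappa> * J < \<infinity>" using finH(2) by (rule le_less_trans)
    then show ?thesis using \<kappa> by (auto simp: ennreal_mult_less_top)
  qed
  then obtain j where j: "J = ennreal j" "0 \<le> j" by (cases J) auto
  have bound: "b\<^sup>2 * \<kappa> * j \<le> a\<^sup>2 * \<epsilon>" if \<epsilon>: "0 < \<epsilon>" "\<epsilon> \<le> 1" for \<epsilon>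
  proof -
    have "I \<epsilon> \<le> I 0" using order_trans[OF _ ineq2[of \<epsilon>], of "I \<epsilon>"] \<epsilon> by simp
    then have "I \<epsilon> < \<infinity>" using finH(2) by (rule le_less_trans)
    then obtain i i0 h0 where i: "I \<epsilon> = ennreal i" "0 \<le> i" "I 0 = ennreal i0" "0 \<le> i0" "H = ennreal h0" "0 \<le> h0"
      using finH by (cases "I \<epsilon>"; cases "I 0"; cases H) auto
    have "ennreal (i + \<epsilon> * \<kappa> * j) \<le> ennreal i0"
      using ineq2[of \<epsilon>] \<epsilon> \<kappa> i j by (simp add: ennreal_plus ennreal_mult)
    then have 1: "i + \<epsilon> * \<kappa> * j \<le> i0" using i by (simp add: ennreal_le_iff)
    have "ennreal (a\<^sup>2 * h0 + b\<^sup>2 * i0) \<le> ennreal (a\<^sup>2 * (h0 + \<epsilon>\<^sup>2) + b\<^sup>2 * i)"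
      using ineq1[of \<epsilon>] \<epsilon> i by (simp add: ennreal_plus ennreal_mult)
    moreover have "0 \<le> a\<^sup>2 * (h0 + \<epsilon>\<^sup>2) + b\<^sup>2 * i" using i by simp
    ultimately have "a\<^sup>2 * h0 + b\<^sup>2 * i0 \<le> a\<^sup>2 * (h0 + \<epsilon>\<^sup>2) + b\<^sup>2 * i" by (simp add: ennreal_le_iff)
    moreover have "b\<^sup>2 * (i + \<epsilon> * \<kappa> * j) \<le> b\<^sup>2 * i0" using 1 by (intro mult_left_mono) auto
    ultimately have "\<epsilon> * (b\<^sup>2 * \<kappa> * j) \<le> \<epsilon> * (a\<^sup>2 * \<epsilon>)" by (simp add: algebra_simps power2_eq_square)
    then show ?thesis using \<epsilon> by simp
  qed
  have "j = 0"
  proof (rule ccontr)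
    assume "j \<noteq> 0"
    then have pos: "0 < b\<^sup>2 * \<kappa> * j" using j \<kappa> ab by simp
    \<comment> \<open>Half the critical value, so that \<open>bound\<close> fails.\<close>
    define \<epsilon> where "\<epsilon> = min 1 (b\<^sup>2 * \<kappa> * j / (2 * a\<^sup>2))"
    have "0 < \<epsilon>" "\<epsilon> \<le> 1" using pos ab by (auto simp: \<epsilon>_def)
    then have "b\<^sup>2 * \<kappa> * j \<le> a\<^sup>2 * \<epsilon>" by (rule bound)
    also have "\<dots> \<le> a\<^sup>2 * (b\<^sup>2 * \<kappa> * j / (2 * a\<^sup>2))" by (intro mult_left_mono) (auto simp: \<epsilon>_def)
    also have "\<dots> = b\<^sup>2 * \<kappa> * j / 2" using ab by simp
    finally show False using pos by linarith
  qed
  then have "J = 0" using j by simp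
  moreover have [measurable]: "B 1 \<in> borel_measurable ?M" by (rule B_meas) simp
  ultimately have "AE t in ?M. ennreal (\<phi> t) * B 1 t = 0"
    unfolding J_def by (subst (asm) nn_integral_0_iff_AE) auto
  with AE_space show ?thesis
  proof eventually_elim
    case (elim t)
    then have t: "t \<in> {0..1}" by simp
    have "\<phi> t = 0 \<or> B 1 t = 0" using elim(2) \<phi>(2)[OF t] by auto
    moreover have nn: "\<And>x. 0 \<le> \<nu> 1 t x" using CE[of 1] t by (auto simp: CE_def densities_def)
    have "B 1 t = 0 \<longleftrightarrow> flux_action K \<pi> (\<mu> t) (V t) = 0"
      unfolding B_def flux_action_eq_0_iff[OF nn K \<pi>] flux_action_eq_0_iff[OF \<mu>[OF t] K \<pi>] ..
    ultimately show ?case by simp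
  qed
qed

section \<open>The source term of a minimizer\<close>

text \<open>
  The perturbation \<open>\<phi> = g * (G - g)\<close> first adds mass and then removes it again, using only times
  in \<open>Z\<close>; it vanishes at both ends because \<open>g\<close> runs from 0 to \<open>G\<close>.
\<close>

theorem lemma3p7:
  fixes K :: "'a::finite \<Rightarrow> 'a \<Rightarrow> real"
    and \<pi> p \<mu>0 \<mu>1 :: "'a \<Rightarrow> real"
    and a b :: real
    and \<mu> :: "real \<Rightarrow> 'a \<Rightarrow> real"
    and V :: "real \<Rightarrow> 'a \<Rightarrow> 'a \<Rightarrow> real"
    and h :: "real \<Rightarrow> real"
  assumes "markov_kernel K"
    and "irreducible_kernel K"
    and "invariant_probability K \<pi>"
    and "reversible_kernel K \<pi>"
    and "0 < a" and "0 < b"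
    and "p \<in> pos_densities" and "(\<Sum>x\<in>UNIV. p x * \<pi> x) = 1"
    and "\<mu>0 \<in> densities" and "\<mu>1 \<in> densities" and "\<mu>0 \<noteq> \<mu>1"
    and "is_arg_min (quad_energy a b K \<pi>) (\<lambda>\<gamma>. \<gamma> \<in> CE K p \<mu>0 \<mu>1) (\<mu>, V, h)"
  shows "AE t in lebesgue_on {0..1}. h t \<noteq> 0"
proof -
  note min = assms(12)
  have \<gamma>: "(\<mu>, V, h) \<in> CE K p \<mu>0 \<mu>1" using min by (simp add: is_arg_min_def)
  have K: "0 \<le> K x y" for x y using assms(1) by (simp add: markov_kernel_def)
  have \<pi>: "0 < \<pi> x" for x by (rule invariant_probability_pos[OF assms(1-3)])
  have p: "0 < p x" for x using assms(7) by (simp add: pos_densities_def)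
  define E where "E = quad_energy a b K \<pi> (\<mu>, V, h)"
  have fin: "E < \<infinity>"
  proof -
    obtain \<gamma>' where "\<gamma>' \<in> CE K p \<mu>0 \<mu>1" "quad_energy a b K \<pi> \<gamma>' < \<infinity>"
      using ex_finite_energy[OF assms(1-4,7-10)] by blast
    then show ?thesis using min unfolding E_def is_arg_min_def by (meson not_le le_less_trans)
  qed
  have speed: "AE t in lebesgue_on {0..1}. energy_density a b K \<pi> \<mu> V h t = E"
    using minimizer_constant_speed[OF min] fin unfolding E_def by blast
  have "E \<noteq> 0"
    using CE_zero_energy[OF \<gamma> assms(5,6) K \<pi> assms(4)] speed assms(11) by auto
  have h[measurable]: "h \<in> borel_measurable (lebesgue_on {0..1})" by (rule CE_borel_measurable(3)[OF \<gamma>])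
  define Z where "Z = {t \<in> {0..1}. h t = 0}"
  have "{t \<in> space (lebesgue_on {0..1}). h t = 0} \<in> sets (lebesgue_on {0..1})" by measurable
  then have Zs: "Z \<in> sets lebesgue" by (simp add: Z_def sets_restrict_space_iff)
  have Zm: "Z \<inter> {u..v} \<in> lmeasurable" for u v
    using Zs by (intro fmeasurable_Int_fmeasurable[of "{u..v}" lebesgue Z, unfolded Int_commute[of "{u..v}"]]) auto
  have iZ: "indicat_real Z integrable_on {u..v}" for u v
    using Zm by (simp add: integrable_on_indicator)
  define g where "g t = integral {0..t} (indicat_real Z)" for t
  define G where "G = g 1"
  have gm: "g y - g x = measure lebesgue (Z \<inter> {x..y})" if "0 \<le> x" "x \<le> y" for x y
  proof -
    have "g x + integral {x..y} (indicat_real Z) = g y"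
      unfolding g_def using that iZ by (intro Henstock_Kurzweil_Integration.integral_combine) auto
    then show ?thesis using integral_indicator[OF Zm] by simp
  qed
  have incr: "0 \<le> g y - g x" "g y - g x \<le> y - x" if "0 \<le> x" "x \<le> y" for x y
  proof -
    show "0 \<le> g y - g x" using gm[OF that] by simp
    have "measure lebesgue (Z \<inter> {x..y}) \<le> measure lebesgue {x..y}"
      using Zm by (intro measure_mono_fmeasurable) auto
    then show "g y - g x \<le> y - x" using gm[OF that] that by simp
  qed
  have g0: "g 0 = 0" by (simp add: g_def)
  have g01: "0 \<le> g t" "g t \<le> G" "g t \<le> 1" "G \<le> 1" if "t \<in> {0..1}" for t
    using incr[of 0 t] incr[of t 1] incr[of 0 1] that g0 by (auto simp: G_def)
  have lip: "1-lipschitz_on {0..1} g"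
  proof (rule lipschitz_onI)
    fix x y :: real assume "x \<in> {0..1}" "y \<in> {0..1}"
    then show "dist (g x) (g y) \<le> 1 * dist x y"
      using incr[of x y] incr[of y x] by (cases "x \<le> y") (auto simp: dist_real_def)
  qed simp
  have lipP: "(C * 1)-lipschitz_on {0..1} (\<lambda>t. P (g t))"
    if "\<And>s. (P has_real_derivative P' s) (at s within {0..1})" "\<And>s. s \<in> {0..1} \<Longrightarrow> \<bar>P' s\<bar> \<le> C" "0 \<le> C" for P P' C
  proof -
    have "C-lipschitz_on {0..1} P" by (rule lipschitz_onI_bounded_derivative[OF that])
    then have "C-lipschitz_on (g ` {0..1}) P" by (rule lipschitz_on_subset) (use g01 in auto)
    from lipschitz_on_compose[OF lip this] show ?thesis by (simp add: o_def)
  qed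
  have dg: "AE t in lebesgue_on {0..1}. (g has_real_derivative indicat_real Z t) (at t within {0..1})"
  proof -
    obtain N where N: "negligible N"
      "\<And>t. t \<in> {0..1} - N \<Longrightarrow> (g has_real_derivative indicat_real Z t) (at t within {0..1})"
      using has_real_derivative_indefinite_integral_AE[OF iZ[of 0 1]] unfolding g_def[abs_def] by metis
    have "{t \<in> {0..1}. \<not> (g has_real_derivative indicat_real Z t) (at t within {0..1})} \<subseteq> N"
      using N(2) by blast
    then show ?thesis unfolding AE_lebesgue_on_iff_negligible using N(1) negligible_subset by blast
  qed
  define \<phi> where "\<phi> t = g t * (G - g t)" for t
  define \<psi> where "\<psi> t = indicat_real Z t * (G - 2 * g t)" for t
  have G01: "0 \<le> G" "G \<le> 1" using g01[of 0] by auto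
  have "AE t in lebesgue_on {0..1}. \<phi> t = 0 \<or> flux_action K \<pi> (\<mu> t) (V t) = 0"
  proof (rule minimizer_no_flux_where_mass_can_be_added[OF min _ assms(5,6) K \<pi> p])
    show "quad_energy a b K \<pi> (\<mu>, V, h) < \<infinity>" using fin by (simp add: E_def)
    show "(2 * 1)-lipschitz_on {0..1} \<phi>" unfolding \<phi>_def[abs_def]
      by (rule lipP[where P = "\<lambda>s. s * (G - s)" and P' = "\<lambda>s. G - 2 * s"])
         (use G01 in \<open>auto intro!: derivative_eq_intros\<close>)
    show "0 \<le> \<phi> t" if "t \<in> {0..1}" for t using g01[OF that] by (simp add: \<phi>_def)
    show "\<phi> 0 = 0" "\<phi> 1 = 0" by (simp_all add: \<phi>_def g0 G_def)
    have "continuous_on {0..1} g" using lip by (rule lipschitz_on_continuous_on)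
    then have [measurable]: "g \<in> borel_measurable (lebesgue_on {0..1})"
      by (intro continuous_imp_measurable_on_sets_lebesgue) auto
    have [measurable]: "indicat_real Z \<in> borel_measurable (lebesgue_on {0..1})"
      using Zs by (intro measurable_restrict_space1 borel_measurable_indicator)
    show "\<psi> \<in> borel_measurable (lebesgue_on {0..1})" unfolding \<psi>_def[abs_def] by measurable
    show "\<bar>\<psi> t\<bar> \<le> 1" if "t \<in> {0..1}" for t
      using g01[OF that] G01 by (auto simp: \<psi>_def indicator_def)
    show "h t * \<psi> t = 0" for t by (simp add: \<psi>_def Z_def indicator_def)
    show "AE t in lebesgue_on {0..1}. (\<phi> has_real_derivative \<psi> t) (at t within {0..1})"
      using dg unfolding \<phi>_def[abs_def] \<psi>_def
      by eventually_elim (auto intro!: derivative_eq_intros simp: algebra_simps)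
  qed
  with speed AE_space dg
  have dq: "AE t in lebesgue_on {0..1}. ((\<lambda>t. G * (g t)\<^sup>2 / 2 - (g t)^3 / 3) has_real_derivative 0) (at t within {0..1})"
  proof eventually_elim
    case (elim t)
    have zero: "indicat_real Z t * \<phi> t = 0"
    proof (cases "t \<in> Z")
      case True
      then have "h t = 0" by (simp add: Z_def)
      \<comment> \<open>At constant positive speed, a time without source needs flux.\<close>
      then have "flux_action K \<pi> (\<mu> t) (V t) \<noteq> 0"
        using elim(1) \<open>E \<noteq> 0\<close> by (auto simp: energy_density_def)
      then show ?thesis using elim(4) by simp
    qed simp
    have "((\<lambda>t. G * (g t)\<^sup>2 / 2 - (g t)^3 / 3) has_real_derivative indicat_real Z t * \<phi> t) (at t within {0..1})"
      using elim(3) unfolding \<phi>_def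
      by (auto intro!: derivative_eq_intros simp: algebra_simps power2_eq_square)
    then show ?case unfolding zero .
  qed
  have "(2 * 1)-lipschitz_on {0..1} (\<lambda>t. G * (g t)\<^sup>2 / 2 - (g t)^3 / 3)"
  proof (rule lipP[where P = "\<lambda>s. G * s\<^sup>2 / 2 - s^3 / 3" and P' = "\<lambda>s. G * s - s\<^sup>2"])
    fix s :: real
    show "((\<lambda>s. G * s\<^sup>2 / 2 - s^3 / 3) has_real_derivative G * s - s\<^sup>2) (at s within {0..1})"
      by (auto intro!: derivative_eq_intros simp: power2_eq_square)
    assume "s \<in> {0..1}"
    then have "0 \<le> G * s" "G * s \<le> 1" "0 \<le> s\<^sup>2" "s\<^sup>2 \<le> 1" using G01 by (auto simp: mult_le_one power_le_one)
    then show "\<bar>G * s - s\<^sup>2\<bar> \<le> 2" by linarith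
  qed simp
  then have "absolutely_continuous_on {0..1} (\<lambda>t. G * (g t)\<^sup>2 / 2 - (g t)^3 / 3)"
    by (rule absolutely_continuous_onI_lipschitz)
  \<comment> \<open>The increment of this function over the unit interval is \<open>G ^ 3 / 6\<close>.\<close>
  from absolutely_continuous_on_zero_derivative[OF _ this dq[unfolded AE_lebesgue_on_iff_negligible]]
  have "G * (g 1)\<^sup>2 / 2 - (g 1)^3 / 3 = G * (g 0)\<^sup>2 / 2 - (g 0)^3 / 3" by auto
  then have "G * G\<^sup>2 / 2 - G^3 / 3 = 0" unfolding G_def[symmetric] g0 by simp
  then have "G^3 = 0" by (simp add: power2_eq_square power3_eq_cube)
  then have "measure lebesgue (Z \<inter> {0..1}) = 0" using gm[of 0 1] g0 by (simp add: G_def)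
  then have "negligible (Z \<inter> {0..1})" using Zm negligible_iff_measure by blast
  moreover have "Z \<inter> {0..1} = {t \<in> {0..1}. \<not> h t \<noteq> 0}" by (auto simp: Z_def)
  ultimately show ?thesis unfolding AE_lebesgue_on_iff_negligible by simp
qed

end
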